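(* Let $k\geq 2$ be an integer and let $\Omega\subset\mathbb{R}^2$ be a $k$-rotationally symmetric planar convex body. Then its Cheeger set $C_\Omega$ is $k$-rotationally symmetric.
   Context: A planar convex body is a compact convex subset of $\mathbb{R}^2$ with nonempty interior. Rotational symmetry. For an integer $k\geq 2$, a planar convex body $\Omega$ is $k$-rotationally symmetric if there exists a point $p\in\Omega$ (the center of symmetry) such that $\Omega$ is invariant under the rotation $\theta_k$ of angle $2\pi/k$ centered at $p$. Cheeger set. For a bounded measurable set $X\subset\mathbb{R}^2$, $P(X)$ denotes the perimeter of $X$ (the one-dimensional Hausdorff measure of $\partial X$) and $A(X)$ its area. The Cheeger constant of a planar convex body $\Omega$ is $h(\Omega)=\inf P(X)/A(X)$, the infimum being over all measurable sets $X\subseteq\Omega$ with $A(X)>0$. A Cheeger set of $\Omega$ is a set $X\subseteq\Omega$ attaining this infimum. It is known that for a planar convex body a Cheeger set exists and is unique (up to sets of zero area) and convex; $C_\Omega$ denotes its closed representative, i.e. the unique closed convex set $C_\Omega\subseteq\Omega$ with positive area and $P(C_\Omega)/A(C_\Omega)=h(\Omega)$. *)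

theory Defs
  imports "HOL-Analysis.Analysis"
begin

definition planar_convex_body :: "(real^2) set \<Rightarrow> bool" where
  "planar_convex_body \<Omega> \<longleftrightarrow> compact \<Omega> \<and> convex \<Omega> \<and> interior \<Omega> \<noteq> {}"

definition rotation_about :: "real^2 \<Rightarrow> real \<Rightarrow> real^2 \<Rightarrow> real^2" where
  "rotation_about p t x =
     p + vector [cos t * (x - p) $ 1 - sin t * (x - p) $ 2,
                 sin t * (x - p) $ 1 + cos t * (x - p) $ 2]"

definition rotationally_symmetric :: "nat \<Rightarrow> (real^2) set \<Rightarrow> bool" where
  "rotationally_symmetric k \<Omega> \<longleftrightarrow>
     planar_convex_body \<Omega> \<and> (\<exists>p\<in>\<Omega>. rotation_about p (2 * pi / real k) ` \<Omega> = \<Omega>)"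

(* The sets of a cover are required to be bounded because the library's diameter is 0
   on unbounded sets.  Empty sets have diameter 0, so finite covers are included. *)
definition hausdorff_pre_measure1 :: "real \<Rightarrow> 'a::metric_space set \<Rightarrow> ennreal" where
  "hausdorff_pre_measure1 \<delta> S =
     (INF U \<in> {U :: nat \<Rightarrow> 'a set. S \<subseteq> (\<Union>i. U i) \<and> (\<forall>i. bounded (U i) \<and> diameter (U i) \<le> \<delta>)}.
        \<Sum>i. ennreal (diameter (U i)))"

definition hausdorff_measure1 :: "'a::metric_space set \<Rightarrow> ennreal" where
  "hausdorff_measure1 S = (SUP \<delta> \<in> {0<..}. hausdorff_pre_measure1 \<delta> S)"

definition perimeter :: "(real^2) set \<Rightarrow> ennreal" where
  "perimeter X = hausdorff_measure1 (frontier X)"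

definition area :: "(real^2) set \<Rightarrow> ennreal" where
  "area X = emeasure lebesgue X"

definition cheeger_constant :: "(real^2) set \<Rightarrow> ennreal" where
  "cheeger_constant \<Omega> =
     (INF X \<in> {X. X \<in> sets lebesgue \<and> X \<subseteq> \<Omega> \<and> area X > 0}. perimeter X / area X)"

definition is_cheeger_set :: "(real^2) set \<Rightarrow> (real^2) set \<Rightarrow> bool" where
  "is_cheeger_set \<Omega> X \<longleftrightarrow>
     X \<in> sets lebesgue \<and> X \<subseteq> \<Omega> \<and> area X > 0 \<and> perimeter X / area X = cheeger_constant \<Omega>"

(* For a planar convex body there is exactly one such C; it is the set written C_Omega. *)
definition is_closed_cheeger_set :: "(real^2) set \<Rightarrow> (real^2) set \<Rightarrow> bool" where
  "is_closed_cheeger_set \<Omega> C \<longleftrightarrow> closed C \<and> convex C \<and> is_cheeger_set \<Omega> C"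

end

theory Submission imports Defs begin

text \<open>Let \<open>L\<close> be the image of the Cheeger set \<open>C\<close> under the rotation that preserves \<open>\<Omega>\<close>, and let \<open>M\<close> be the set
  of midpoints of a point of \<open>C\<close> and a point of \<open>L\<close>. Both are convex subsets of \<open>\<Omega>\<close>, and \<open>L\<close> is congruent
  to \<open>C\<close>. Two facts about Minkowski sums of planar convex bodies are played off against each other.

  Perimeter is at most averaged (lemma \<open>perimeter_midpoints\<close>), so \<open>M\<close> has at most the perimeter of \<open>C\<close>; as
  \<open>C\<close> minimises perimeter divided by area among subsets of \<open>\<Omega>\<close>, the area of \<open>M\<close> is at most that of \<open>C\<close>. But
  by the equality case of the Brunn--Minkowski inequality (proposition \<open>brunn_minkowski_equality\<close>) the
  midpoints of two bodies of equal area occupy a larger area unless one body is a translate of the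
  other. Hence \<open>L\<close> is a translate of \<open>C\<close>. A rotation combined with a translation is a rotation by the
  same angle about some other point, so \<open>C\<close> is invariant under a rotation by \<open>2 \<pi> / k\<close>, whose centre
  lies in \<open>C\<close> (lemma \<open>rotation_about_translated_center\<close>).

  The perimeter is the Hausdorff measure of the boundary, and it is computed by comparison with
  polygons. The nearest point map onto a convex set is 1-Lipschitz, so boundary measure is monotone
  on convex sets, and a body can be replaced by a circumscribed polygon with almost the same
  perimeter. For polygons, the edge of \<open>M\<close> with a given normal consists of midpoints of the faces with
  that normal, and its length is at most the average of theirs.

  The area statement is proved by slicing: vertical sections of the two bodies that cut off the same
  area on the left are matched, and the areas cut off from \<open>M\<close> at the midpoints are differentiated.
  Equality forces matched sections to be equally long and their upper ends to differ by a constant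
  vector.\<close>

section \<open>One-dimensional Hausdorff measure\<close>

lemma diameter_leI:
  fixes S :: "'a::metric_space set"
  assumes "0 \<le> d" "\<And>x y. x \<in> S \<Longrightarrow> y \<in> S \<Longrightarrow> dist x y \<le> d"
  shows "diameter S \<le> d"
  using assms by (auto simp: diameter_def intro!: cSUP_least)

definition small_cover :: "real \<Rightarrow> 'a::metric_space set \<Rightarrow> (nat \<Rightarrow> 'a set) \<Rightarrow> bool" where
  "small_cover \<delta> S U \<longleftrightarrow> S \<subseteq> (\<Union>i. U i) \<and> (\<forall>i. bounded (U i) \<and> diameter (U i) \<le> \<delta>)"

lemma pre_measure_eq:
  "hausdorff_pre_measure1 \<delta> S = (INF U \<in> Collect (small_cover \<delta> S). \<Sum>i. ennreal (diameter (U i)))"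
proof -
  have "small_cover \<delta> S = (\<lambda>U. S \<subseteq> (\<Union>i. U i) \<and> (\<forall>i. bounded (U i) \<and> diameter (U i) \<le> \<delta>))"
    by (rule ext) (simp add: small_cover_def)
  then show ?thesis by (simp add: hausdorff_pre_measure1_def)
qed

lemma pre_measure_le:
  "small_cover \<delta> S U \<Longrightarrow> hausdorff_pre_measure1 \<delta> S \<le> (\<Sum>i. ennreal (diameter (U i)))"
  unfolding pre_measure_eq by (rule INF_lower) simp

lemma le_pre_measureI:
  assumes "\<And>U. small_cover \<delta> S U \<Longrightarrow> x \<le> (\<Sum>i. ennreal (diameter (U i)))"
  shows "x \<le> hausdorff_pre_measure1 \<delta> S"
  unfolding pre_measure_eq by (rule INF_greatest) (use assms in simp)

lemma pre_measure_le_measure: "0 < \<delta> \<Longrightarrow> hausdorff_pre_measure1 \<delta> S \<le> hausdorff_measure1 S"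
  unfolding hausdorff_measure1_def by (rule SUP_upper) simp

lemma hausdorff_measure1_leI:
  assumes "\<And>\<delta>. 0 < \<delta> \<Longrightarrow> hausdorff_pre_measure1 \<delta> S \<le> x"
  shows "hausdorff_measure1 S \<le> x"
  unfolding hausdorff_measure1_def by (rule SUP_least) (use assms in simp)

lemma pre_measure_antimono:
  "\<delta> \<le> \<delta>' \<Longrightarrow> hausdorff_pre_measure1 \<delta>' S \<le> hausdorff_pre_measure1 \<delta> S"
  by (rule le_pre_measureI, rule pre_measure_le) (auto simp: small_cover_def intro: order_trans)

lemma hausdorff_measure1_mono:
  assumes "S \<subseteq> T" shows "hausdorff_measure1 S \<le> hausdorff_measure1 T"
proof (rule hausdorff_measure1_leI)
  fix \<delta> :: real assume "0 < \<delta>"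
  have "hausdorff_pre_measure1 \<delta> S \<le> hausdorff_pre_measure1 \<delta> T"
    by (rule le_pre_measureI, rule pre_measure_le) (use assms in \<open>auto simp: small_cover_def\<close>)
  then show "hausdorff_pre_measure1 \<delta> S \<le> hausdorff_measure1 T"
    using pre_measure_le_measure[OF \<open>0 < \<delta>\<close>] order_trans by blast
qed

lemma hausdorff_measure1_empty [simp]: "hausdorff_measure1 {} = 0"
proof -
  have "hausdorff_measure1 ({}::'a set) \<le> 0"
  proof (rule hausdorff_measure1_leI)
    fix \<delta> :: real assume "0 < \<delta>"
    then have "small_cover \<delta> ({}::'a set) (\<lambda>i. {})" by (simp add: small_cover_def)
    from pre_measure_le[OF this] show "hausdorff_pre_measure1 \<delta> ({}::'a set) \<le> 0" by simp
  qed
  then show ?thesis by simp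
qed

lemma hausdorff_measure1_lipschitz_image:
  fixes f :: "'a::metric_space \<Rightarrow> 'b::metric_space"
  assumes f: "c-lipschitz_on S f" and c: "0 < c"
  shows "hausdorff_measure1 (f ` S) \<le> ennreal c * hausdorff_measure1 S"
proof (rule hausdorff_measure1_leI)
  fix \<delta> :: real assume \<delta>: "0 < \<delta>"
  have "hausdorff_pre_measure1 \<delta> (f ` S) / ennreal c \<le> hausdorff_pre_measure1 (\<delta> / c) S"
  proof (rule le_pre_measureI)
    fix U assume U: "small_cover (\<delta> / c) S U"
    define V where "V i = f ` (U i \<inter> S)" for i
    have bU: "bounded (U i)" for i using U by (simp add: small_cover_def)
    have distV: "dist x y \<le> c * diameter (U i)" if xy: "x \<in> V i" "y \<in> V i" for x y i
    proof -
      obtain x' y' where x: "x = f x'" "x' \<in> U i \<inter> S" and y: "y = f y'" "y' \<in> U i \<inter> S"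
        using xy unfolding V_def by blast
      have "dist x y \<le> c * dist x' y'" using f x y by (auto dest: lipschitz_onD)
      also have "\<dots> \<le> c * diameter (U i)"
        using c x y diameter_bounded_bound[OF bU] by (auto intro!: mult_left_mono)
      finally show "dist x y \<le> c * diameter (U i)" .
    qed
    then have dV: "diameter (V i) \<le> c * diameter (U i)" for i
      using c diameter_ge_0[OF bU] by (intro diameter_leI) auto
    have "bounded (V i)" for i using distV bounded_two_points by blast
    moreover have "diameter (V i) \<le> \<delta>" for i
    proof -
      have "c * diameter (U i) \<le> c * (\<delta> / c)"
        using U c by (intro mult_left_mono) (auto simp: small_cover_def)
      then show ?thesis using dV[of i] c by simp
    qed
    moreover have "f ` S \<subseteq> (\<Union>i. V i)" using U unfolding small_cover_def V_def by blast
    ultimately have "small_cover \<delta> (f ` S) V" by (simp add: small_cover_def)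
    then have "hausdorff_pre_measure1 \<delta> (f ` S) \<le> (\<Sum>i. ennreal (diameter (V i)))"
      by (rule pre_measure_le)
    also have "\<dots> \<le> (\<Sum>i. ennreal c * ennreal (diameter (U i)))"
      using c dV diameter_ge_0[OF bU]
      by (intro suminf_le summableI) (auto simp flip: ennreal_mult intro!: ennreal_leI)
    also have "\<dots> = ennreal c * (\<Sum>i. ennreal (diameter (U i)))" by simp
    finally show "hausdorff_pre_measure1 \<delta> (f ` S) / ennreal c \<le> (\<Sum>i. ennreal (diameter (U i)))"
      using c by (intro divide_le_posI_ennreal) auto
  qed
  also have "\<dots> \<le> hausdorff_measure1 S" using \<delta> c by (intro pre_measure_le_measure) simp
  finally have "ennreal c * (hausdorff_pre_measure1 \<delta> (f ` S) / ennreal c) \<le> ennreal c * hausdorff_measure1 S"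
    by (rule mult_left_mono) simp
  then show "hausdorff_pre_measure1 \<delta> (f ` S) \<le> ennreal c * hausdorff_measure1 S"
    using c by (simp add: ennreal_times_divide ennreal_mult_divide_eq mult.commute[of "ennreal c"])
qed

lemma pre_measure_Un:
  "hausdorff_pre_measure1 \<delta> (S \<union> T) \<le> hausdorff_pre_measure1 \<delta> S + hausdorff_pre_measure1 \<delta> T"
proof (rule ennreal_le_epsilon)
  fix e :: real assume fin: "hausdorff_pre_measure1 \<delta> S + hausdorff_pre_measure1 \<delta> T < top" and e: "0 < e"
  have ex: "\<exists>U. small_cover \<delta> X U \<and> (\<Sum>i. ennreal (diameter (U i))) \<le> hausdorff_pre_measure1 \<delta> X + ennreal (e/2)"
    if "hausdorff_pre_measure1 \<delta> X < top" for X :: "'a set"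
    using INF_approx_ennreal[of "e/2" "hausdorff_pre_measure1 \<delta> X", OF _ pre_measure_eq] e that
    by (force intro: less_imp_le)
  obtain U V where U: "small_cover \<delta> S U" "(\<Sum>i. ennreal (diameter (U i))) \<le> hausdorff_pre_measure1 \<delta> S + ennreal (e/2)"
    and V: "small_cover \<delta> T V" "(\<Sum>i. ennreal (diameter (V i))) \<le> hausdorff_pre_measure1 \<delta> T + ennreal (e/2)"
    using ex[of S] ex[of T] fin by (auto simp: ennreal_add_eq_top less_top)
  \<comment> \<open>The two covers are interleaved into a single sequence.\<close>
  define W where "W n = (if even n then U (n div 2) else V (n div 2))" for n
  have W2: "W (n * 2) = U n" "W (Suc (n * 2)) = V n" for n by (simp_all add: W_def)
  have "x \<in> (\<Union>n. W n)" if "x \<in> S \<union> T" for x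
  proof -
    have "(\<exists>n. x \<in> U n) \<or> (\<exists>n. x \<in> V n)" using that U V by (auto simp: small_cover_def)
    then show ?thesis using W2 by blast
  qed
  then have "small_cover \<delta> (S \<union> T) W" using U V by (simp add: small_cover_def W_def subset_eq)
  then have "hausdorff_pre_measure1 \<delta> (S \<union> T) \<le> (\<Sum>i. ennreal (diameter (W i)))" by (rule pre_measure_le)
  also have "\<dots> \<le> (\<Sum>i. ennreal (diameter (U i))) + (\<Sum>i. ennreal (diameter (V i)))"
  proof (rule suminf_le_const[OF summableI])
    fix n
    have eq: "(\<Sum>i<n*2. ennreal (diameter (W i))) = (\<Sum>i<n. ennreal (diameter (U i))) + (\<Sum>i<n. ennreal (diameter (V i)))"
      by (induction n) (simp_all add: W2 algebra_simps)
    have "(\<Sum>i<n. ennreal (diameter (W i))) \<le> (\<Sum>i<n*2. ennreal (diameter (W i)))"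
      by (rule sum_mono2) auto
    also have "\<dots> \<le> (\<Sum>i. ennreal (diameter (U i))) + (\<Sum>i. ennreal (diameter (V i)))"
      unfolding eq by (intro add_mono sum_le_suminf summableI) auto
    finally show "(\<Sum>i<n. ennreal (diameter (W i))) \<le> \<dots>" .
  qed
  also have "\<dots> \<le> (hausdorff_pre_measure1 \<delta> S + ennreal (e/2)) + (hausdorff_pre_measure1 \<delta> T + ennreal (e/2))"
    using U V by (intro add_mono)
  also have "\<dots> = hausdorff_pre_measure1 \<delta> S + hausdorff_pre_measure1 \<delta> T + (ennreal (e/2) + ennreal (e/2))"
    by (simp add: ac_simps)
  also have "ennreal (e/2) + ennreal (e/2) = ennreal e" using e by (simp flip: ennreal_plus)
  finally show "hausdorff_pre_measure1 \<delta> (S \<union> T) \<le> hausdorff_pre_measure1 \<delta> S + hausdorff_pre_measure1 \<delta> T + ennreal e" .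
qed

lemma hausdorff_measure1_Un: "hausdorff_measure1 (S \<union> T) \<le> hausdorff_measure1 S + hausdorff_measure1 T"
proof (rule hausdorff_measure1_leI)
  fix \<delta> :: real assume "0 < \<delta>"
  then show "hausdorff_pre_measure1 \<delta> (S \<union> T) \<le> hausdorff_measure1 S + hausdorff_measure1 T"
    using order_trans[OF pre_measure_Un] pre_measure_le_measure by (meson add_mono)
qed

lemma hausdorff_measure1_UN:
  "finite I \<Longrightarrow> hausdorff_measure1 (\<Union>i\<in>I. S i) \<le> (\<Sum>i\<in>I. hausdorff_measure1 (S i))"
  by (induction rule: finite_induct) (auto intro: order_trans[OF hausdorff_measure1_Un] add_left_mono)

text \<open>Once the scale is below the distance between the sets, no set of a cover meets both of them.\<close>

lemma hausdorff_measure1_separated: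
  assumes d: "0 < d" and sep: "\<And>x y. x \<in> S \<Longrightarrow> y \<in> T \<Longrightarrow> d \<le> dist x y"
  shows "hausdorff_measure1 S + hausdorff_measure1 T \<le> hausdorff_measure1 (S \<union> T)"
proof -
  \<comment> \<open>The sets of a cover of the union are distributed over \<open>S\<close> and \<open>T\<close>, replacing the others by the empty set.\<close>
  have small: "hausdorff_pre_measure1 \<delta> S + hausdorff_pre_measure1 \<delta> T \<le> hausdorff_pre_measure1 \<delta> (S \<union> T)"
    if \<delta>: "0 < \<delta>" "\<delta> < d" for \<delta>
  proof (rule le_pre_measureI)
    fix U assume U: "small_cover \<delta> (S \<union> T) U"
    define V where "V X i = (if U i \<inter> X = {} then {} else U i)" for X i
    have one: "U i \<inter> S = {} \<or> U i \<inter> T = {}" for i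
    proof (rule ccontr)
      assume "\<not> ?thesis"
      then obtain x y where "x \<in> U i" "x \<in> S" "y \<in> U i" "y \<in> T" by blast
      moreover have "bounded (U i)" "diameter (U i) \<le> \<delta>" using U by (auto simp: small_cover_def)
      ultimately show False
        using sep[of x y] diameter_bounded_bound[of "U i" x y] \<delta> by auto
    qed
    have "small_cover \<delta> X (V X)" if X: "X \<subseteq> S \<union> T" for X
      unfolding small_cover_def
    proof (intro conjI allI)
      show "X \<subseteq> (\<Union>i. V X i)"
      proof
        fix x assume x: "x \<in> X"
        then obtain i where "x \<in> U i" using U X unfolding small_cover_def by blast
        then have "x \<in> V X i" using x unfolding V_def by auto
        then show "x \<in> (\<Union>i. V X i)" by blast
      qed
    qed (use U \<delta> in \<open>auto simp: V_def small_cover_def\<close>)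
    then have "hausdorff_pre_measure1 \<delta> S + hausdorff_pre_measure1 \<delta> T
        \<le> (\<Sum>i. ennreal (diameter (V S i))) + (\<Sum>i. ennreal (diameter (V T i)))"
      by (intro add_mono pre_measure_le) auto
    also have "\<dots> = (\<Sum>i. ennreal (diameter (V S i)) + ennreal (diameter (V T i)))"
      by (simp add: suminf_add)
    also have "\<dots> \<le> (\<Sum>i. ennreal (diameter (U i)))"
    proof (intro suminf_le summableI)
      fix i show "ennreal (diameter (V S i)) + ennreal (diameter (V T i)) \<le> ennreal (diameter (U i))"
        using one[of i] by (auto simp: V_def)
    qed
    finally show "hausdorff_pre_measure1 \<delta> S + hausdorff_pre_measure1 \<delta> T \<le> (\<Sum>i. ennreal (diameter (U i)))" .
  qed
  have "hausdorff_pre_measure1 \<delta>1 S + hausdorff_pre_measure1 \<delta>2 T \<le> hausdorff_measure1 (S \<union> T)"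
    if "0 < \<delta>1" "0 < \<delta>2" for \<delta>1 \<delta>2
  proof -
    define \<delta> where "\<delta> = min (d/2) (min \<delta>1 \<delta>2)"
    have \<delta>: "0 < \<delta>" "\<delta> < d" using that d by (auto simp: \<delta>_def)
    have "hausdorff_pre_measure1 \<delta>1 S + hausdorff_pre_measure1 \<delta>2 T
       \<le> hausdorff_pre_measure1 \<delta> S + hausdorff_pre_measure1 \<delta> T"
      by (intro add_mono pre_measure_antimono) (auto simp: \<delta>_def)
    then show ?thesis using small[OF \<delta>] pre_measure_le_measure[OF \<delta>(1), of "S \<union> T"]
      by (rule order_trans[OF order_trans])
  qed
  then show ?thesis
    unfolding hausdorff_measure1_def[of S] hausdorff_measure1_def[of T]
    by (simp add: ennreal_SUP_add_left[symmetric] ennreal_SUP_add_right SUP_le_iff)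
qed

text \<open>Disjoint compact sets lie at positive distance from one another. This is the form of additivity by
  which the edge lengths of a polygon are added up.\<close>

lemma hausdorff_measure1_disjoint_compact:
  fixes S :: "'i \<Rightarrow> 'a::heine_borel set"
  assumes "finite I" "\<And>i. i \<in> I \<Longrightarrow> compact (S i)"
    "\<And>i j. i \<in> I \<Longrightarrow> j \<in> I \<Longrightarrow> i \<noteq> j \<Longrightarrow> S i \<inter> S j = {}"
  shows "(\<Sum>i\<in>I. hausdorff_measure1 (S i)) \<le> hausdorff_measure1 (\<Union>i\<in>I. S i)"
  using assms
proof (induction rule: finite_induct)
  case (insert i I)
  let ?T = "\<Union>j\<in>I. S j"
  have "S i \<inter> S j = {}" if "j \<in> I" for j using that insert.hyps insert.prems(2)[of i j] by auto
  then have "S i \<inter> ?T = {}" by blast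
  moreover have "compact (S i)" "compact ?T"
    using insert.hyps insert.prems(1) by (auto intro!: compact_UN)
  ultimately obtain d where "0 < d" "\<forall>x\<in>S i. \<forall>y\<in>?T. d \<le> dist x y"
    using separate_compact_closed[of "S i" ?T] compact_imp_closed[of ?T] by blast
  then have sep: "hausdorff_measure1 (S i) + hausdorff_measure1 ?T \<le> hausdorff_measure1 (S i \<union> ?T)"
    by (intro hausdorff_measure1_separated[of d]) auto
  have "(\<Sum>j\<in>I. hausdorff_measure1 (S j)) \<le> hausdorff_measure1 ?T"
    by (rule insert.IH) (use insert.prems in simp_all)
  from order_trans[OF add_left_mono[OF this] sep]
  show ?case using insert.hyps by simp
qed simp

text \<open>A bounded set of reals lies in an interval as long as its diameter, so countable subadditivity of
  Lebesgue measure bounds the total diameter of a cover from below.\<close>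

lemma length_le_hausdorff_measure1_real:
  assumes "0 \<le> l" shows "ennreal l \<le> hausdorff_measure1 {0..l}"
proof -
  have "ennreal l \<le> hausdorff_pre_measure1 1 {0..l}"
  proof (rule le_pre_measureI)
    fix U assume U: "small_cover 1 {0..l} U"
    have bU: "bounded (U i)" for i using U by (simp add: small_cover_def)
    define V where "V i = closure (U i)" for i
    have mV: "V i \<in> sets lborel" for i by (simp add: V_def)
    have "emeasure lborel (V i) \<le> ennreal (diameter (U i))" for i
    proof (cases "U i = {}")
      case False
      have c: "compact (V i)" "V i \<noteq> {}" using bU False by (auto simp: V_def)
      obtain a where a: "a \<in> V i" "\<forall>x\<in>V i. a \<le> x" using compact_attains_inf[OF c] by blast
      obtain b where b: "b \<in> V i" "\<forall>x\<in>V i. x \<le> b" using compact_attains_sup[OF c] by blast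
      have "emeasure lborel (V i) \<le> emeasure lborel {a..b}"
        using a b by (intro emeasure_mono) auto
      also have "\<dots> = ennreal (b - a)" using a b by (intro emeasure_lborel_Icc) auto
      also have "ennreal (b - a) \<le> ennreal (diameter (U i))"
      proof (rule ennreal_leI)
        have "dist b a \<le> diameter (V i)"
          using diameter_bounded_bound[OF compact_imp_bounded[OF c(1)] b(1) a(1)] .
        then show "b - a \<le> diameter (U i)"
          using diameter_closure[OF bU, of i] by (simp add: V_def dist_real_def)
      qed
      finally show ?thesis .
    next
      case True then show ?thesis by (simp add: V_def)
    qed
    then have sum: "(\<Sum>i. emeasure lborel (V i)) \<le> (\<Sum>i. ennreal (diameter (U i)))"
      by (intro suminf_le summableI)
    have cov: "{0..l} \<subseteq> (\<Union>i. V i)"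
    proof -
      have "{0..l} \<subseteq> (\<Union>i. U i)" using U by (simp add: small_cover_def)
      also have "\<dots> \<subseteq> (\<Union>i. V i)" by (rule UN_mono) (simp_all add: V_def closure_subset)
      finally show ?thesis .
    qed
    have "ennreal l = emeasure lborel {0..l}" using assms by simp
    also have "\<dots> \<le> emeasure lborel (\<Union>i. V i)"
      by (rule emeasure_mono[OF cov]) (use mV in \<open>simp add: sets.countable_UN\<close>)
    also have "\<dots> \<le> (\<Sum>i. emeasure lborel (V i))"
      by (rule emeasure_subadditive_countably) (use mV in blast)
    also note sum
    finally show "ennreal l \<le> (\<Sum>i. ennreal (diameter (U i)))" .
  qed
  also have "\<dots> \<le> hausdorff_measure1 {0..l}" by (rule pre_measure_le_measure) simp
  finally show ?thesis .
qed

text \<open>Cut the interval into \<open>n\<close> pieces of equal length; their total diameter does not depend on \<open>n\<close>.\<close>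

lemma hausdorff_measure1_real_le:
  assumes "0 \<le> l" shows "hausdorff_measure1 {0..l} \<le> ennreal l"
proof (rule hausdorff_measure1_leI)
  fix \<delta> :: real assume \<delta>: "0 < \<delta>"
  obtain n :: nat where n: "l / \<delta> < real n" using reals_Archimedean2 by blast
  then have n0: "0 < n" using assms \<delta>
    by (metis divide_nonneg_pos gr0I linorder_not_le of_nat_0)
  define U where "U i = (if i < n then {l * i / n .. l * (i + 1) / n} else {})" for i
  have dU: "diameter (U i) = (if i < n then l / n else 0)" for i :: nat
  proof -
    have "l * i / n \<le> l * (i + 1) / n" using assms by (intro divide_right_mono mult_left_mono) auto
    moreover have "l * (i + 1) / n - l * i / n = l / n"
      by (simp add: ring_distribs add_divide_distrib)
    ultimately show ?thesis by (simp add: U_def del: of_nat_Suc)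
  qed
  have "x \<in> (\<Union>i. U i)" if x: "x \<in> {0..l}" for x
  proof (cases "x = l")
    case True
    have "l * real (n - 1) / n \<le> l * n / n" using assms by (intro divide_right_mono mult_left_mono) auto
    then have "x \<in> U (n - 1)" using n0 True by (simp add: U_def of_nat_diff)
    then show ?thesis by blast
  next
    case False
    then have l: "0 < l" "x < l" using x by auto
    define i where "i = nat \<lfloor>x * n / l\<rfloor>"
    have i: "real i \<le> x * n / l" "x * n / l < real i + 1"
      using x l by (auto simp: i_def)
    have "x * n / l < n" using l n0 by (simp add: field_simps)
    then have "i < n" using i by linarith
    then have "x \<in> U i" using i l n0 by (auto simp: U_def field_simps)
    then show ?thesis by blast
  qed
  moreover have "l / n \<le> \<delta>" using n \<delta> n0 by (simp add: field_simps)
  moreover have "bounded (U i)" for i by (simp add: U_def)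
  ultimately have "small_cover \<delta> {0..l} U" using \<delta> by (auto simp: small_cover_def dU)
  then have "hausdorff_pre_measure1 \<delta> {0..l} \<le> (\<Sum>i. ennreal (diameter (U i)))" by (rule pre_measure_le)
  also have "\<dots> = (\<Sum>i<n. ennreal (l / n))"
    by (subst suminf_finite[of "{..<n}"]) (auto simp: dU)
  also have "\<dots> = ennreal (\<Sum>i<n. l / n)" using assms by (intro sum_ennreal) simp
  also have "(\<Sum>i<n. l / n) = l" using n0 by simp
  finally show "hausdorff_pre_measure1 \<delta> {0..l} \<le> ennreal l" .
qed

lemma hausdorff_measure1_segment:
  fixes a b :: "'a::real_inner"
  shows "hausdorff_measure1 (closed_segment a b) = ennreal (dist a b)"
proof (rule antisym)
  define l where "l = dist a b"
  define u where "u = (b - a) /\<^sub>R l"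
  have l0: "0 \<le> l" by (simp add: l_def)
  have lu: "l *\<^sub>R u = b - a" by (cases "l = 0") (auto simp: u_def l_def)
  have nu: "norm u \<le> 1" by (cases "l = 0") (auto simp: u_def l_def dist_norm norm_minus_commute)
  have seg: "closed_segment a b = (\<lambda>t. a + t *\<^sub>R u) ` {0..l}"
  proof safe
    fix x assume "x \<in> closed_segment a b"
    then obtain t where t: "0 \<le> t" "t \<le> 1" "x = a + t *\<^sub>R (b - a)"
      by (auto simp: closed_segment_def algebra_simps)
    then have "x = a + (t * l) *\<^sub>R u" by (simp add: lu flip: scaleR_scaleR)
    moreover have "t * l \<in> {0..l}" using t l0 by (auto simp: mult_left_le_one_le)
    ultimately show "x \<in> (\<lambda>t. a + t *\<^sub>R u) ` {0..l}" by blast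
  next
    fix t assume t: "t \<in> {0..l}"
    show "a + t *\<^sub>R u \<in> closed_segment a b"
    proof (cases "l = 0")
      case False
      then have "t / l \<in> {0..1}" using t by auto
      moreover have "a + t *\<^sub>R u = (1 - t / l) *\<^sub>R a + (t / l) *\<^sub>R b"
        by (simp add: u_def algebra_simps divide_inverse)
      ultimately show ?thesis by (auto simp: closed_segment_def)
    qed (use t in auto)
  qed
  have "1-lipschitz_on {0..l} (\<lambda>t. a + t *\<^sub>R u)"
  proof (rule lipschitz_onI)
    fix s t :: real
    have "dist (a + s *\<^sub>R u) (a + t *\<^sub>R u) = \<bar>s - t\<bar> * norm u"
      by (simp add: dist_norm flip: scaleR_diff_left)
    also have "\<dots> \<le> \<bar>s - t\<bar> * 1" using nu by (intro mult_left_mono) auto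
    finally show "dist (a + s *\<^sub>R u) (a + t *\<^sub>R u) \<le> 1 * dist s t" by (simp add: dist_real_def)
  qed simp
  then have "hausdorff_measure1 (closed_segment a b) \<le> ennreal 1 * hausdorff_measure1 {0..l}"
    unfolding seg by (rule hausdorff_measure1_lipschitz_image) simp
  also have "\<dots> \<le> ennreal l" using hausdorff_measure1_real_le[OF l0] by simp
  finally show "hausdorff_measure1 (closed_segment a b) \<le> ennreal (dist a b)" by (simp add: l_def)

  \<comment> \<open>Conversely, the coordinate along the segment is a 1-Lipschitz map onto an interval of its length.\<close>
  show "ennreal (dist a b) \<le> hausdorff_measure1 (closed_segment a b)"
  proof (cases "l = 0")
    case False
    then have l: "0 < l" using l0 by simp
    have nu1: "norm u = 1" using False by (auto simp: u_def l_def dist_norm norm_minus_commute)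
    have "{0..l} = (\<lambda>x. (x - a) \<bullet> u) ` closed_segment a b"
      unfolding seg image_image using nu1 by (auto simp: norm_eq_1)
    moreover have "1-lipschitz_on (closed_segment a b) (\<lambda>x. (x - a) \<bullet> u)"
    proof (rule lipschitz_onI)
      fix x y
      have "dist ((x - a) \<bullet> u) ((y - a) \<bullet> u) = \<bar>(x - y) \<bullet> u\<bar>"
        by (simp add: dist_real_def algebra_simps)
      also have "\<dots> \<le> norm (x - y) * norm u" by (rule Cauchy_Schwarz_ineq2)
      finally show "dist ((x - a) \<bullet> u) ((y - a) \<bullet> u) \<le> 1 * dist x y" by (simp add: nu1 dist_norm)
    qed simp
    ultimately have "hausdorff_measure1 {0..l} \<le> ennreal 1 * hausdorff_measure1 (closed_segment a b)"
      using hausdorff_measure1_lipschitz_image[of 1] by force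
    then show ?thesis using length_le_hausdorff_measure1_real[OF l0] by (simp add: l_def)
  qed (simp add: l_def)
qed

section \<open>Boundaries of nested convex sets\<close>

text \<open>From a boundary point \<open>x\<close> of \<open>S\<close> follow an outer normal until it leaves \<open>T\<close>. Every point of that ray
  is projected back to \<open>x\<close> by the nearest point map of \<open>S\<close>.\<close>

lemma frontier_subset_closest_point_image:
  fixes S T :: "'a::euclidean_space set"
  assumes S: "convex S" "closed S" and ST: "S \<subseteq> T" and T: "bounded T"
  shows "frontier S \<subseteq> closest_point S ` frontier T"
proof
  fix x assume x: "x \<in> frontier S"
  then have xS: "x \<in> S" using S frontier_subset_closed by blast
  obtain u where u: "u \<noteq> 0" "\<And>y. y \<in> S \<Longrightarrow> u \<bullet> y \<le> u \<bullet> x"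
  proof (cases "interior S = {}")
    case True
    then obtain a b where "a \<noteq> 0" "S \<subseteq> {x. a \<bullet> x = b}"
      using empty_interior_subset_hyperplane[OF S(1)] by blast
    then have "a \<bullet> y = b" if "y \<in> S" for y using that by blast
    with \<open>a \<noteq> 0\<close> show ?thesis using that[of a] xS by auto
  next
    case False
    then have "x \<notin> rel_interior S" using x by (simp add: rel_interior_nonempty_interior frontier_def)
    moreover have "x \<in> closure S" using xS closure_subset by blast
    ultimately obtain a where "a \<noteq> 0" "\<And>y. y \<in> closure S \<Longrightarrow> a \<bullet> x \<le> a \<bullet> y"
      using supporting_hyperplane_relative_frontier[OF S(1)] by metis
    then show ?thesis using that[of "- a"] closure_subset by auto
  qed
  show "x \<in> closest_point S ` frontier T"
  proof (cases "x \<in> frontier T")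
    case True
    then show ?thesis using closest_point_self[OF xS] by (metis image_eqI)
  next
    case False
    then have "x \<in> interior T" using xS ST closure_subset[of T] by (auto simp: frontier_def)
    then obtain d where d: "0 < d" "x + d *\<^sub>R u \<in> frontier T"
      using ray_to_frontier[OF T _ u(1)] by metis
    have "x = closest_point S (x + d *\<^sub>R u)"
    proof (rule closest_point_unique[OF S xS], rule ballI)
      fix z assume "z \<in> S"
      have "0 \<le> u \<bullet> (x - z)" using u(2)[OF \<open>z \<in> S\<close>] by (simp add: inner_diff_right)
      then have "0 \<le> 2 * d * (u \<bullet> (x - z)) + (x - z) \<bullet> (x - z)"
        using d by (intro add_nonneg_nonneg mult_nonneg_nonneg inner_ge_zero) auto
      then have "(d *\<^sub>R u) \<bullet> (d *\<^sub>R u) \<le> (d *\<^sub>R u + (x - z)) \<bullet> (d *\<^sub>R u + (x - z))"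
        by (simp add: inner_add_left inner_add_right inner_commute)
      then have "norm (d *\<^sub>R u) \<le> norm (d *\<^sub>R u + (x - z))" by (simp only: norm_le)
      then show "dist (x + d *\<^sub>R u) x \<le> dist (x + d *\<^sub>R u) z"
        by (simp add: dist_norm algebra_simps)
    qed
    then show ?thesis using d by blast
  qed
qed

text \<open>Convex sets inside other sets have shorter boundaries, because the nearest point map is
  1-Lipschitz. Every comparison of a body with a polytope inside or around it rests on this.\<close>

lemma hausdorff_measure1_frontier_mono:
  fixes S T :: "'a::euclidean_space set"
  assumes "convex S" "closed S" "S \<subseteq> T" "bounded T"
  shows "hausdorff_measure1 (frontier S) \<le> hausdorff_measure1 (frontier T)"
proof (cases "S = {}")
  case False
  have "hausdorff_measure1 (frontier S) \<le> hausdorff_measure1 (closest_point S ` frontier T)"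
    by (rule hausdorff_measure1_mono[OF frontier_subset_closest_point_image[OF assms]])
  also have "\<dots> \<le> ennreal 1 * hausdorff_measure1 (frontier T)"
    using closest_point_lipschitz[OF assms(1,2) False]
    by (intro hausdorff_measure1_lipschitz_image lipschitz_onI) auto
  finally show ?thesis by simp
qed simp

lemma frontier_injective_linear_image:
  fixes f :: "'a::euclidean_space \<Rightarrow> 'a"
  assumes "linear f" "inj f"
  shows "frontier (f ` S) = f ` frontier S"
  using assms by (simp add: frontier_def closure_injective_linear_image interior_injective_linear_image image_set_diff)

section \<open>Sets of midpoints\<close>

text \<open>Half of the Minkowski sum. The factor one half keeps the set inside any convex set containing
  \<open>K\<close> and \<open>L\<close>, which is what makes it an admissible competitor.\<close>

definition midpoints :: "'a::real_vector set \<Rightarrow> 'a set \<Rightarrow> 'a set" where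
  "midpoints K L = (\<lambda>(x, y). midpoint x y) ` (K \<times> L)"

lemma midpointsI: "x \<in> K \<Longrightarrow> y \<in> L \<Longrightarrow> midpoint x y \<in> midpoints K L"
  by (force simp: midpoints_def)

lemma midpointsE:
  assumes "z \<in> midpoints K L"
  obtains x y where "x \<in> K" "y \<in> L" "z = midpoint x y"
  using assms by (auto simp: midpoints_def)

lemma midpoints_mono: "K \<subseteq> K' \<Longrightarrow> L \<subseteq> L' \<Longrightarrow> midpoints K L \<subseteq> midpoints K' L'"
  by (auto simp: midpoints_def)

lemma midpoints_subset_convex:
  assumes "convex S" "K \<subseteq> S" "L \<subseteq> S" shows "midpoints K L \<subseteq> S"
proof
  fix z assume "z \<in> midpoints K L"
  then obtain x y where "x \<in> K" "y \<in> L" "z = midpoint x y" by (rule midpointsE)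
  then show "z \<in> S" using assms convexD[OF assms(1), of x y "1/2" "1/2"]
    by (auto simp: midpoint_def scaleR_add_right)
qed

lemma linear_midpoint: "linear (\<lambda>(x, y). midpoint x y)"
  by (rule linearI) (auto simp: midpoint_def algebra_simps)

lemma convex_midpoints: "convex K \<Longrightarrow> convex L \<Longrightarrow> convex (midpoints K L)"
  unfolding midpoints_def by (intro convex_linear_image linear_midpoint convex_Times)

lemma compact_midpoints:
  fixes K L :: "'a::euclidean_space set"
  shows "compact K \<Longrightarrow> compact L \<Longrightarrow> compact (midpoints K L)"
  unfolding midpoints_def
  by (intro compact_continuous_image linear_continuous_on linear_midpoint compact_Times)
     (simp add: linear_midpoint linear_linear)

lemma polytope_midpoints:
  fixes K L :: "'a::euclidean_space set"
  shows "polytope K \<Longrightarrow> polytope L \<Longrightarrow> polytope (midpoints K L)"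
  unfolding midpoints_def by (intro polytope_linear_image linear_midpoint polytope_Times)

lemma interior_midpoints:
  fixes K L :: "'a::euclidean_space set"
  assumes "interior K \<noteq> {}" "L \<noteq> {}" shows "interior (midpoints K L) \<noteq> {}"
proof -
  obtain l where l: "l \<in> L" using assms by blast
  have "(+) ((1/2) *\<^sub>R l) ` ((*\<^sub>R) (1/2) ` interior K) \<subseteq> interior (midpoints K L)"
  proof (rule interior_maximal)
    show "open ((+) ((1/2) *\<^sub>R l) ` ((*\<^sub>R) (1/2) ` interior K))"
      by (intro open_translation open_scaling) auto
    show "(+) ((1/2) *\<^sub>R l) ` ((*\<^sub>R) (1/2) ` interior K) \<subseteq> midpoints K L"
    proof
      fix z assume "z \<in> (+) ((1/2) *\<^sub>R l) ` ((*\<^sub>R) (1/2) ` interior K)"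
      then obtain x where x: "x \<in> interior K" "z = (1/2) *\<^sub>R l + (1/2) *\<^sub>R x" by blast
      then have "x \<in> K" using interior_subset by blast
      then have "midpoint x l \<in> midpoints K L" using l by (rule midpointsI)
      moreover have "midpoint x l = z" by (simp add: x midpoint_def algebra_simps)
      ultimately show "z \<in> midpoints K L" by simp
    qed
  qed
  then show ?thesis using assms by blast
qed

section \<open>Faces and the perimeter of polygons\<close>

text \<open>The part of \<open>K\<close> furthest in direction \<open>u\<close>: the edge or vertex with outer normal \<open>u\<close> when \<open>K\<close> is a
  polygon.\<close>

definition support_face :: "'a::real_inner set \<Rightarrow> 'a \<Rightarrow> 'a set" where
  "support_face K u = {x \<in> K. \<forall>y\<in>K. u \<bullet> y \<le> u \<bullet> x}"

text \<open>A linear functional is maximal at a midpoint only if it is maximal at both ends, since either end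
  could be replaced by a better one.\<close>

lemma support_face_midpoints:
  assumes "z \<in> support_face (midpoints K L) u"
  obtains x y where "x \<in> support_face K u" "y \<in> support_face L u" "z = midpoint x y"
proof -
  have z: "z \<in> midpoints K L" "\<And>w. w \<in> midpoints K L \<Longrightarrow> u \<bullet> w \<le> u \<bullet> z"
    using assms by (auto simp: support_face_def)
  obtain x y where xy: "x \<in> K" "y \<in> L" "z = midpoint x y" using z(1) by (rule midpointsE)
  have "u \<bullet> x' \<le> u \<bullet> x" if "x' \<in> K" for x'
    using z(2)[OF midpointsI[OF that xy(2)]] xy by (simp add: midpoint_def inner_add_right)
  moreover have "u \<bullet> y' \<le> u \<bullet> y" if "y' \<in> L" for y'
    using z(2)[OF midpointsI[OF xy(1) that]] xy by (simp add: midpoint_def inner_add_right)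
  ultimately show ?thesis using that[of x y] xy by (auto simp: support_face_def)
qed

lemma diameter_support_face_midpoints:
  fixes K L :: "'a::real_inner set"
  assumes "bounded K" "bounded L"
  shows "diameter (support_face (midpoints K L) u)
           \<le> (diameter (support_face K u) + diameter (support_face L u)) / 2"
proof -
  have bK: "bounded (support_face K u)" and bL: "bounded (support_face L u)"
    using assms by (auto simp: support_face_def intro: bounded_subset)
  show ?thesis
  proof (rule diameter_leI)
    fix z w assume "z \<in> support_face (midpoints K L) u" "w \<in> support_face (midpoints K L) u"
    then obtain x y x' y' where xy: "x \<in> support_face K u" "y \<in> support_face L u" "z = midpoint x y"
        "x' \<in> support_face K u" "y' \<in> support_face L u" "w = midpoint x' y'"
      by (meson support_face_midpoints)
    have "dist z w = norm ((1/2) *\<^sub>R (x - x') + (1/2) *\<^sub>R (y - y'))"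
      by (simp add: xy dist_norm midpoint_def algebra_simps)
    also have "\<dots> \<le> (dist x x' + dist y y') / 2"
      by (rule order_trans[OF norm_triangle_ineq]) (simp add: dist_norm)
    also have "\<dots> \<le> (diameter (support_face K u) + diameter (support_face L u)) / 2"
      using xy diameter_bounded_bound[OF bK] diameter_bounded_bound[OF bL]
      by (intro divide_right_mono add_mono) auto
    finally show "dist z w \<le> (diameter (support_face K u) + diameter (support_face L u)) / 2" .
  qed (use diameter_ge_0[OF bK] diameter_ge_0[OF bL] in simp)
qed

text \<open>The face lies on a line perpendicular to \<open>u\<close>, where compact convex sets are segments.\<close>

lemma support_face_segment:
  fixes K :: "(real^2) set"
  assumes K: "compact K" "convex K" "K \<noteq> {}" and u: "u \<noteq> 0"
  obtains a b where "support_face K u = closed_segment a b"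
proof -
  obtain x where x: "x \<in> K" "\<forall>y\<in>K. u \<bullet> y \<le> u \<bullet> x"
    using continuous_attains_sup[OF K(1,3) continuous_on_inner[OF continuous_on_const continuous_on_id], of u]
    by (auto simp: id_def)
  have eq: "support_face K u = K \<inter> {y. u \<bullet> y = u \<bullet> x}"
    using x by (auto simp: support_face_def intro: antisym)
  have "aff_dim (support_face K u) \<le> aff_dim {y. u \<bullet> y = u \<bullet> x}" by (rule aff_dim_subset) (simp add: eq)
  then have "collinear (support_face K u)" using u by (simp add: collinear_aff_dim)
  moreover have "compact (support_face K u)" "convex (support_face K u)" "support_face K u \<noteq> {}"
    using K x by (auto simp: eq intro: compact_Int_closed closed_hyperplane convex_Int convex_hyperplane)
  ultimately show ?thesis using that compact_convex_collinear_segment by metis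
qed

lemma diameter_closed_segment:
  fixes a b :: "'a::euclidean_space"
  shows "diameter (closed_segment a b) = dist a b"
proof (rule antisym)
  show "diameter (closed_segment a b) \<le> dist a b"
  proof (rule diameter_leI)
    fix x y assume "x \<in> closed_segment a b" "y \<in> closed_segment a b"
    then show "dist x y \<le> dist a b"
      using segment_furthest_le[of x a b y] by (metis dist_norm dist_commute segment_bound(1,2) order_trans norm_minus_commute)
  qed simp
  show "dist a b \<le> diameter (closed_segment a b)"
    by (rule diameter_bounded_bound) (auto intro: compact_imp_bounded)
qed

lemma support_face_subset_frontier:
  fixes K :: "'a::euclidean_space set"
  assumes "u \<noteq> 0" shows "support_face K u \<subseteq> frontier K"
proof
  fix x assume x: "x \<in> support_face K u"
  then have "K \<subseteq> {y. u \<bullet> y \<le> u \<bullet> x}" by (auto simp: support_face_def)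
  then have "interior K \<subseteq> {y. u \<bullet> y < u \<bullet> x}"
    using interior_mono interior_halfspace_le[OF assms] by metis
  then show "x \<in> frontier K" using x closure_subset[of K] by (auto simp: frontier_def support_face_def)
qed

text \<open>Lagrange's identity \<open>(u \<bullet> v)\<^sup>2 + det(u, v)\<^sup>2 = |u|\<^sup>2 |v|\<^sup>2\<close>, in which the determinant vanishes
  because \<open>u\<close> and \<open>v\<close> are both perpendicular to \<open>w\<close>.\<close>

lemma plane_unit_orthogonal:
  fixes u v w :: "real^2"
  assumes "norm u = 1" "norm v = 1" "u \<bullet> w = 0" "v \<bullet> w = 0" "w \<noteq> 0"
  shows "v = u \<or> v = - u"
proof -
  have ip: "x \<bullet> y = x$1 * y$1 + x$2 * y$2" for x y :: "real^2" by (simp add: inner_vec_def sum_2)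
  have n: "(u$1)\<^sup>2 + (u$2)\<^sup>2 = 1" "(v$1)\<^sup>2 + (v$2)\<^sup>2 = 1"
    using assms(1,2) by (simp_all add: norm_eq_1 ip power2_eq_square)
  have o: "u$1 * w$1 + u$2 * w$2 = 0" "v$1 * w$1 + v$2 * w$2 = 0" using assms by (simp_all add: ip)
  define d where "d = u$1 * v$2 - u$2 * v$1"
  have "d * w$1 = 0" "d * w$2 = 0" unfolding d_def using o by algebra+
  moreover have "w$1 \<noteq> 0 \<or> w$2 \<noteq> 0" using assms(5) by (auto simp: vec_eq_iff forall_2)
  ultimately have "d = 0" by auto
  have "(u \<bullet> v)\<^sup>2 + d\<^sup>2 = ((u$1)\<^sup>2 + (u$2)\<^sup>2) * ((v$1)\<^sup>2 + (v$2)\<^sup>2)" unfolding ip d_def by algebra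
  then have "(u \<bullet> v)\<^sup>2 = 1" using \<open>d = 0\<close> n by simp
  then have "u \<bullet> v = 1 \<or> u \<bullet> v = -1" by (simp add: power2_eq_1_iff)
  moreover have "(v - u) \<bullet> (v - u) = 2 - 2 * (u \<bullet> v)" "(v + u) \<bullet> (v + u) = 2 + 2 * (u \<bullet> v)"
    using assms(1,2) by (simp_all add: norm_eq_1 inner_diff_left inner_diff_right inner_add_left inner_add_right inner_commute)
  ultimately have "v - u = 0 \<or> v + u = 0" by (metis inner_eq_zero_iff add.right_inverse diff_self mult_minus1_right mult_1_right one_add_one)
  then show ?thesis by (auto simp: eq_neg_iff_add_eq_0)
qed

text \<open>Two common points would force \<open>v = - u\<close>, and then the whole of \<open>K\<close> would lie between two coinciding
  lines.\<close>

lemma support_faces_meet_in_one_point: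
  fixes K :: "(real^2) set"
  assumes K: "interior K \<noteq> {}" and uv: "norm u = 1" "norm v = 1" "u \<noteq> v"
    and x: "x \<in> support_face K u" "x \<in> support_face K v"
    and y: "y \<in> support_face K u" "y \<in> support_face K v"
  shows "x = y"
proof (rule ccontr)
  assume "x \<noteq> y"
  have xu: "\<And>z. z \<in> K \<Longrightarrow> u \<bullet> z \<le> u \<bullet> x" and xv: "\<And>z. z \<in> K \<Longrightarrow> v \<bullet> z \<le> v \<bullet> x"
    and yu: "\<And>z. z \<in> K \<Longrightarrow> u \<bullet> z \<le> u \<bullet> y" and yv: "\<And>z. z \<in> K \<Longrightarrow> v \<bullet> z \<le> v \<bullet> y"
    and xy: "x \<in> K" "y \<in> K"
    using x y by (simp_all add: support_face_def)
  have "u \<bullet> (x - y) = 0" "v \<bullet> (x - y) = 0"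
    using xu[OF xy(2)] yu[OF xy(1)] xv[OF xy(2)] yv[OF xy(1)] by (simp_all add: inner_diff_right)
  then have "v = - u" using plane_unit_orthogonal[OF uv(1,2)] uv(3) \<open>x \<noteq> y\<close> by auto
  then have "u \<bullet> z = u \<bullet> x" if "z \<in> K" for z using xu[OF that] xv[OF that] by simp
  then have "interior K \<subseteq> interior {z. u \<bullet> z = u \<bullet> x}" by (intro interior_mono) auto
  moreover have "u \<noteq> 0" using uv by auto
  ultimately show False using K interior_hyperplane[of u "u \<bullet> x"] by simp
qed

text \<open>The edges of \<open>K\<close> in different directions are essentially disjoint parts of its boundary. The lemma
  holds for any convex body and any finite set of directions, so it applies to \<open>K\<close> with the edge
  normals of another polygon.\<close>

lemma sum_diameter_support_face_le:
  fixes K :: "(real^2) set"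
  assumes K: "compact K" "convex K" "interior K \<noteq> {}"
    and N: "finite N" "\<And>u. u \<in> N \<Longrightarrow> norm u = 1"
  shows "(\<Sum>u\<in>N. ennreal (diameter (support_face K u))) \<le> hausdorff_measure1 (frontier K)"
proof -
  have nz: "u \<noteq> 0" if "u \<in> N" for u using N(2)[OF that] by auto
  have Kne: "K \<noteq> {}" using K(3) by auto
  have "\<forall>u\<in>N. \<exists>a b. support_face K u = closed_segment a b"
    using support_face_segment[OF K(1,2) Kne] nz by metis
  then obtain a b where ab: "\<And>u. u \<in> N \<Longrightarrow> support_face K u = closed_segment (a u) (b u)"
    by metis
  define D where "D = (\<Sum>u\<in>N. dist (a u) (b u))"
  \<comment> \<open>Shrinking the edges towards their midpoints by a factor z makes them disjoint.\<close>
  have shrunk: "ennreal (z * D) \<le> hausdorff_measure1 (frontier K)" if z: "0 < z" "z < 1" for z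
  proof -
    define p where "p t u = (1 - t) *\<^sub>R a u + t *\<^sub>R b u" for t :: real and u
    define E where "E u = (if a u = b u then {} else closed_segment (p ((1 - z)/2) u) (p ((1 + z)/2) u))" for u
    have E_open: "E u \<subseteq> open_segment (a u) (b u)" for u
    proof (cases "a u = b u")
      case False
      have "p ((1 - z)/2) u \<in> open_segment (a u) (b u)" "p ((1 + z)/2) u \<in> open_segment (a u) (b u)"
        unfolding in_segment p_def using z False
        by (intro conjI exI[of _ "(1 - z)/2"], simp_all) (intro exI[of _ "(1 + z)/2"], simp)
      then show ?thesis using False by (simp add: E_def closed_segment_subset convex_open_segment)
    qed (simp add: E_def)
    have E_face: "E u \<subseteq> support_face K u" if "u \<in> N" for u
      using E_open[of u] ab[OF that] segment_open_subset_closed by blast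
    have H_E: "hausdorff_measure1 (E u) = ennreal (z * dist (a u) (b u))" for u
    proof (cases "a u = b u")
      case False
      have p_diff: "p s u - p t u = (t - s) *\<^sub>R (a u - b u)" for s t by (simp add: p_def algebra_simps)
      have "(1 + z)/2 - (1 - z)/2 = z" by (simp add: field_simps)
      then have "p ((1 - z)/2) u - p ((1 + z)/2) u = z *\<^sub>R (a u - b u)" by (simp only: p_diff)
      then have "dist (p ((1 - z)/2) u) (p ((1 + z)/2) u) = z * dist (a u) (b u)"
        using z by (simp add: dist_norm)
      then show ?thesis using False by (simp add: E_def hausdorff_measure1_segment)
    qed (simp add: E_def)
    \<comment> \<open>An inner point of the edge \<open>v\<close> on the edge \<open>u\<close> would pull both ends of the edge \<open>v\<close> onto the edge \<open>u\<close>.\<close>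
    have disj: "E u \<inter> E v = {}" if u: "u \<in> N" and v: "v \<in> N" and "u \<noteq> v" for u v
    proof (rule ccontr)
      assume "E u \<inter> E v \<noteq> {}"
      then obtain x where x: "x \<in> E u" "x \<in> E v" by blast
      then have ne: "a v \<noteq> b v" by (auto simp: E_def split: if_splits)
      have xu: "x \<in> support_face K u" using E_face[OF u] x by blast
      have ends: "a v \<in> support_face K v" "b v \<in> support_face K v" using ab[OF v] by auto
      then have endsK: "a v \<in> K" "b v \<in> K" by (auto simp: support_face_def)
      have le: "u \<bullet> a v \<le> u \<bullet> x" "u \<bullet> b v \<le> u \<bullet> x" using xu endsK by (auto simp: support_face_def)
      obtain t where t: "0 < t" "t < 1" "x = (1 - t) *\<^sub>R a v + t *\<^sub>R b v"
        using subsetD[OF E_open x(2)] unfolding in_segment by blast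
      have "u \<bullet> x = (1 - t) * (u \<bullet> a v) + t * (u \<bullet> b v)" by (simp add: t(3) inner_add_right)
      then have "(1 - t) * (u \<bullet> x - u \<bullet> a v) + t * (u \<bullet> x - u \<bullet> b v) = 0"
        by (simp add: algebra_simps)
      moreover have "0 \<le> (1 - t) * (u \<bullet> x - u \<bullet> a v)" "0 \<le> t * (u \<bullet> x - u \<bullet> b v)"
        using le t by auto
      ultimately have "(1 - t) * (u \<bullet> x - u \<bullet> a v) = 0" "t * (u \<bullet> x - u \<bullet> b v) = 0" by linarith+
      then have "u \<bullet> a v = u \<bullet> x" "u \<bullet> b v = u \<bullet> x" using t by auto
      then have "a v \<in> support_face K u" "b v \<in> support_face K u"
        using xu endsK by (auto simp: support_face_def)
      then show False
        using support_faces_meet_in_one_point[OF K(3) N(2)[OF u] N(2)[OF v] \<open>u \<noteq> v\<close>] ends ne by blast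
    qed
    have "ennreal (z * D) = (\<Sum>u\<in>N. hausdorff_measure1 (E u))"
      using z by (simp add: H_E D_def sum_distrib_left sum_ennreal)
    also have "\<dots> \<le> hausdorff_measure1 (\<Union>u\<in>N. E u)"
      by (rule hausdorff_measure1_disjoint_compact[OF N(1)]) (use disj in \<open>auto simp: E_def\<close>)
    also have "\<dots> \<le> hausdorff_measure1 (frontier K)"
      using E_face support_face_subset_frontier[OF nz] by (intro hausdorff_measure1_mono UN_least) blast
    finally show ?thesis .
  qed
  have "ennreal D \<le> hausdorff_measure1 (frontier K)"
  proof (cases "hausdorff_measure1 (frontier K)")
    case (real h)
    have "D \<le> h"
    proof (rule field_le_mult_one_interval)
      fix z :: real assume "0 < z" "z < 1"
      then show "z * D \<le> h" using shrunk[of z] real by simp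
    qed
    then show ?thesis using real by (simp add: ennreal_leI)
  qed simp
  moreover have "(\<Sum>u\<in>N. ennreal (diameter (support_face K u))) = ennreal D"
    unfolding D_def by (subst sum_ennreal[symmetric]) (simp_all add: ab diameter_closed_segment)
  ultimately show ?thesis by simp
qed

text \<open>The boundary of a polygon is the union of its finitely many facets, and each facet is the face in
  the direction of its outer unit normal.\<close>

lemma hausdorff_measure1_frontier_polytope_le:
  fixes M :: "(real^2) set"
  assumes M: "polytope M" "interior M \<noteq> {}"
  obtains N where "finite N" "\<And>u. u \<in> N \<Longrightarrow> norm u = 1"
    "hausdorff_measure1 (frontier M) \<le> (\<Sum>u\<in>N. ennreal (diameter (support_face M u)))"
proof -
  have cM: "compact M" "convex M" "M \<noteq> {}"
    using M polytope_imp_compact polytope_imp_convex by auto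
  define \<F> where "\<F> = {F. F facet_of M}"
  have fin: "finite \<F>" unfolding \<F>_def by (rule finite_polytope_facets[OF M(1)])
  have fr: "frontier M = \<Union>\<F>"
    using rel_frontier_of_polyhedron[OF polytope_imp_polyhedron[OF M(1)]]
      rel_frontier_nonempty_interior[OF M(2)] by (simp add: \<F>_def)
  have "\<exists>u. norm u = 1 \<and> F = support_face M u" if "F \<in> \<F>" for F
  proof -
    have F: "F face_of M" "F \<noteq> {}" "F \<noteq> M" using that by (auto simp: \<F>_def facet_of_def)
    then have "F exposed_face_of M"
      using exposed_face_of_polyhedron[OF polytope_imp_polyhedron[OF M(1)]] by blast
    then obtain c d where cd: "c \<noteq> 0" "M \<subseteq> {x. c \<bullet> x \<le> d}" "F = M \<inter> {x. c \<bullet> x = d}"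
      using F unfolding exposed_face_of by blast
    define u where "u = c /\<^sub>R norm c"
    have u: "u \<bullet> x \<le> u \<bullet> y \<longleftrightarrow> c \<bullet> x \<le> c \<bullet> y" for x y using cd(1) by (simp add: u_def)
    obtain x0 where "x0 \<in> M" "c \<bullet> x0 = d" using F(2) cd(3) by blast
    then have "F = support_face M u" unfolding support_face_def u using cd(2,3) by force
    moreover have "norm u = 1" using cd(1) by (simp add: u_def)
    ultimately show ?thesis by blast
  qed
  then obtain n where n: "\<And>F. F \<in> \<F> \<Longrightarrow> norm (n F) = 1" "\<And>F. F \<in> \<F> \<Longrightarrow> F = support_face M (n F)"
    by metis
  have "inj_on n \<F>" by (rule inj_onI) (metis n(2))
  have HF: "hausdorff_measure1 F = ennreal (diameter (support_face M (n F)))" if "F \<in> \<F>" for F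
  proof -
    have "n F \<noteq> 0" using n(1)[OF that] by auto
    then obtain a b where "support_face M (n F) = closed_segment a b"
      using support_face_segment[OF cM] by metis
    then show ?thesis using n(2)[OF that] by (metis diameter_closed_segment hausdorff_measure1_segment)
  qed
  have "hausdorff_measure1 (frontier M) \<le> (\<Sum>F\<in>\<F>. hausdorff_measure1 F)"
    using hausdorff_measure1_UN[OF fin, of "\<lambda>F. F"] by (simp add: fr)
  also have "\<dots> = (\<Sum>u\<in>n ` \<F>. ennreal (diameter (support_face M u)))"
    using HF by (simp add: sum.reindex[OF \<open>inj_on n \<F>\<close>])
  finally show ?thesis using that[of "n ` \<F>"] fin n(1) by blast
qed

text \<open>Take the edge normals of the polygon of midpoints. In each of these directions its edge is at most
  the average of the faces of \<open>P\<close> and \<open>Q\<close>, and the sums of the faces of \<open>P\<close> and of \<open>Q\<close> over all these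
  directions are at most the two perimeters.\<close>

lemma perimeter_midpoints_polytope:
  fixes P Q :: "(real^2) set"
  assumes P: "polytope P" "interior P \<noteq> {}" and Q: "polytope Q" "interior Q \<noteq> {}"
  shows "2 * perimeter (midpoints P Q) \<le> perimeter P + perimeter Q"
proof -
  have cP: "compact P" "convex P" and cQ: "compact Q" "convex Q"
    using P Q polytope_imp_compact polytope_imp_convex by auto
  have "Q \<noteq> {}" using Q(2) by auto
  then obtain N where N: "finite N" "\<And>u. u \<in> N \<Longrightarrow> norm u = 1"
    and le: "hausdorff_measure1 (frontier (midpoints P Q)) \<le> (\<Sum>u\<in>N. ennreal (diameter (support_face (midpoints P Q) u)))"
    using hausdorff_measure1_frontier_polytope_le[OF polytope_midpoints[OF P(1) Q(1)] interior_midpoints[OF P(2)]]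
    by metis
  have nn: "0 \<le> diameter (support_face P u)" "0 \<le> diameter (support_face Q u)" for u
    using bounded_subset[OF compact_imp_bounded[OF cP(1)], of "support_face P u"]
      bounded_subset[OF compact_imp_bounded[OF cQ(1)], of "support_face Q u"]
    by (auto intro!: diameter_ge_0 simp: support_face_def)
  have "2 * hausdorff_measure1 (frontier (midpoints P Q))
      \<le> 2 * (\<Sum>u\<in>N. ennreal (diameter (support_face (midpoints P Q) u)))"
    by (rule mult_left_mono[OF le]) simp
  also have "\<dots> = (\<Sum>u\<in>N. ennreal 2 * ennreal (diameter (support_face (midpoints P Q) u)))"
    by (simp add: sum_distrib_left)
  also have "\<dots> \<le> (\<Sum>u\<in>N. ennreal (diameter (support_face P u)) + ennreal (diameter (support_face Q u)))"
  proof (rule sum_mono)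
    fix u
    have "ennreal 2 * ennreal (diameter (support_face (midpoints P Q) u)) = ennreal (2 * diameter (support_face (midpoints P Q) u))"
      by (rule ennreal_mult'[symmetric]) simp
    also have "\<dots> \<le> ennreal (diameter (support_face P u) + diameter (support_face Q u))"
      using diameter_support_face_midpoints[of P Q u] cP cQ
      by (intro ennreal_leI) (simp add: compact_imp_bounded field_simps)
    finally show "ennreal 2 * ennreal (diameter (support_face (midpoints P Q) u))
        \<le> ennreal (diameter (support_face P u)) + ennreal (diameter (support_face Q u))"
      using nn by simp
  qed
  also have "\<dots> \<le> hausdorff_measure1 (frontier P) + hausdorff_measure1 (frontier Q)"
    unfolding sum.distrib
    using sum_diameter_support_face_le[OF cP P(2) N] sum_diameter_support_face_le[OF cQ Q(2) N]
    by (rule add_mono)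
  finally show ?thesis by (simp add: perimeter_def)
qed

section \<open>The perimeter of the set of midpoints\<close>

text \<open>Cover \<open>K\<close> by finitely many boxes inside \<open>U\<close> and take the convex hull of all their vertices.\<close>

lemma polytope_between:
  fixes K :: "'a::euclidean_space set"
  assumes K: "compact K" and U: "open U" "convex U" and KU: "K \<subseteq> U"
  obtains P where "polytope P" "K \<subseteq> P" "P \<subseteq> U"
proof -
  have "\<exists>a b. x \<in> box a b \<and> cbox a b \<subseteq> U" if "x \<in> K" for x
  proof -
    have "x \<in> U" using KU that by blast
    then obtain a b where "cbox a b \<subseteq> U" "x \<in> box a b" by (rule open_contains_cbox[OF U(1)])
    then show ?thesis by blast
  qed
  then obtain a b where ab: "\<And>x. x \<in> K \<Longrightarrow> x \<in> box (a x) (b x) \<and> cbox (a x) (b x) \<subseteq> U" by metis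
  have "K \<subseteq> (\<Union>x\<in>K. box (a x) (b x))" using ab by blast
  then obtain F where F: "F \<subseteq> K" "finite F" "K \<subseteq> (\<Union>x\<in>F. box (a x) (b x))"
    by (rule compactE_image[OF K open_box])
  have "\<exists>V. finite V \<and> cbox (a x) (b x) = convex hull V" for x
    by (rule closed_interval_as_convex_hull[of "a x" "b x"]) blast
  then obtain V where V: "\<And>x. finite (V x) \<and> cbox (a x) (b x) = convex hull V x" by metis
  define P where "P = convex hull (\<Union>x\<in>F. V x)"
  have "polytope P" unfolding P_def using F V by (intro polytope_convex_hull finite_UN_I) auto
  moreover have "K \<subseteq> P"
  proof
    fix x assume "x \<in> K"
    then obtain y where y: "y \<in> F" "x \<in> box (a y) (b y)" using F(3) by blast
    then have "x \<in> convex hull V y" using V[of y] box_subset_cbox[of "a y" "b y"] by auto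
    moreover have "convex hull V y \<subseteq> P" unfolding P_def using y by (intro hull_mono) blast
    ultimately show "x \<in> P" by blast
  qed
  moreover have "P \<subseteq> U" unfolding P_def
  proof (rule hull_minimal)
    show "(\<Union>x\<in>F. V x) \<subseteq> U"
    proof (rule UN_least)
      fix x assume "x \<in> F"
      then have "cbox (a x) (b x) \<subseteq> U" using ab F(1) by blast
      then show "V x \<subseteq> U" using V[of x] hull_subset[of "V x" convex] by simp
    qed
  qed (rule U(2))
  ultimately show ?thesis using that by blast
qed

text \<open>Dilating \<open>K\<close> about an interior point by \<open>1 + e\<close> moves \<open>K\<close> into the interior of the dilate; a polytope
  between the two has a boundary no longer than that of the dilate.\<close>

lemma circumscribed_polytope:
  fixes K :: "'a::euclidean_space set"
  assumes K: "compact K" "convex K" "interior K \<noteq> {}" and e: "0 < e"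
  obtains P where "polytope P" "K \<subseteq> P"
    "hausdorff_measure1 (frontier P) \<le> ennreal (1 + e) * hausdorff_measure1 (frontier K)"
proof -
  obtain z where z: "z \<in> interior K" using K(3) by blast
  define g where "g x = - e *\<^sub>R z + (1 + e) *\<^sub>R x" for x
  have g_image: "g ` S = (+) (- e *\<^sub>R z) ` ((*\<^sub>R) (1 + e) ` S)" for S by (auto simp: g_def image_image)
  have lin: "linear ((*\<^sub>R) (1 + e) :: 'a \<Rightarrow> 'a)" "inj ((*\<^sub>R) (1 + e) :: 'a \<Rightarrow> 'a)"
    using e by (auto simp: inj_on_def linear_scaleR)
  have int: "interior (g ` S) = g ` interior S" and fr: "frontier (g ` S) = g ` frontier S" for S
    unfolding g_image using lin
    by (simp_all only: interior_translation frontier_translation interior_injective_linear_image frontier_injective_linear_image)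
  have conv: "convex (g ` K)" unfolding g_image using K(2) by (intro convex_translation convex_scaling)
  have comp: "compact (g ` K)" unfolding g_image using K(1) by (intro compact_translation compact_scaling)
  have "K \<subseteq> g ` interior K"
  proof
    fix x assume "x \<in> K"
    have r: "0 < e / (1 + e)" "e / (1 + e) \<le> 1" using e by auto
    have "x - (e / (1 + e)) *\<^sub>R (x - z) \<in> interior K"
      by (rule mem_interior_convex_shrink[OF K(2) z \<open>x \<in> K\<close> r])
    moreover have "g (x - (e / (1 + e)) *\<^sub>R (x - z)) = x"
      using e by (simp add: g_def scaleR_diff_right) (simp add: algebra_simps)
    ultimately show "x \<in> g ` interior K" by (metis image_eqI)
  qed
  then obtain P where P: "polytope P" "K \<subseteq> P" "P \<subseteq> interior (g ` K)"
    using polytope_between[OF K(1) open_interior[of "g ` K"] convex_interior[OF conv]] unfolding int by blast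
  have "hausdorff_measure1 (frontier P) \<le> hausdorff_measure1 (frontier (g ` K))"
    using P interior_subset[of "g ` K"] polytope_imp_convex polytope_imp_closed comp
    by (intro hausdorff_measure1_frontier_mono) (auto intro: compact_imp_bounded)
  also have "\<dots> \<le> ennreal (1 + e) * hausdorff_measure1 (frontier K)"
    unfolding fr
  proof (rule hausdorff_measure1_lipschitz_image)
    show "(1 + e)-lipschitz_on (frontier K) g"
    proof (rule lipschitz_onI)
      fix x y
      have "g x - g y = (1 + e) *\<^sub>R (x - y)" by (simp add: g_def algebra_simps)
      then show "dist (g x) (g y) \<le> (1 + e) * dist x y" using e by (simp add: dist_norm)
    qed (use e in simp)
  qed (use e in simp)
  finally show ?thesis using that P by blast
qed

text \<open>A polytope around \<open>K\<close> has finite perimeter, and that of \<open>K\<close> is at most as large.\<close>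

lemma perimeter_finite:
  fixes K :: "(real^2) set"
  assumes K: "compact K" "convex K" "interior K \<noteq> {}"
  shows "perimeter K < top"
proof -
  obtain P where P: "polytope P" "K \<subseteq> P"
    using polytope_between[OF K(1) open_UNIV convex_UNIV] by blast
  have "interior P \<noteq> {}" using K(3) interior_mono[OF P(2)] by blast
  then obtain N where "finite N"
    "hausdorff_measure1 (frontier P) \<le> (\<Sum>u\<in>N. ennreal (diameter (support_face P u)))"
    using hausdorff_measure1_frontier_polytope_le[OF P(1)] by metis
  moreover have "(\<Sum>u\<in>N. ennreal (diameter (support_face P u))) < top"
    using \<open>finite N\<close> by simp
  moreover have "perimeter K \<le> hausdorff_measure1 (frontier P)"
    unfolding perimeter_def using K P
    by (intro hausdorff_measure1_frontier_mono) (auto intro: compact_imp_closed polytope_imp_bounded)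
  ultimately show ?thesis by (meson le_less_trans)
qed

text \<open>A nondegenerate segment in \<open>K\<close> is a convex set equal to its own frontier, so its length is a lower
  bound for the perimeter.\<close>

lemma perimeter_pos:
  fixes K :: "(real^2) set"
  assumes K: "compact K" "convex K" "interior K \<noteq> {}"
  shows "0 < perimeter K"
proof -
  obtain x where x: "x \<in> interior K" using K(3) by blast
  then obtain r where r: "0 < r" "ball x r \<subseteq> K" using mem_interior by blast
  obtain y where y: "dist x y = r / 2" "0 < r / 2" using vector_choose_dist[of "r/2" x] r by auto
  have "closed_segment x y \<subseteq> K"
    by (rule closed_segment_subset[OF _ _ K(2)]) (use r y in \<open>auto simp: subset_eq\<close>)
  then have "hausdorff_measure1 (frontier (closed_segment x y)) \<le> perimeter K"
    unfolding perimeter_def using K(1)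
    by (intro hausdorff_measure1_frontier_mono) (auto intro: compact_imp_bounded)
  moreover have "frontier (closed_segment x y) = closed_segment x y"
    by (simp add: frontier_def interior_closed_segment_ge2)
  ultimately have "ennreal (r / 2) \<le> perimeter K" using y by (simp add: hausdorff_measure1_segment)
  moreover have "0 < ennreal (r / 2)" using r by simp
  ultimately show ?thesis by (rule less_le_trans[rotated])
qed

text \<open>Circumscribed polytopes of almost the same perimeters reduce the inequality to polygons.\<close>

lemma perimeter_midpoints:
  fixes K L :: "(real^2) set"
  assumes K: "compact K" "convex K" "interior K \<noteq> {}" and L: "compact L" "convex L" "interior L \<noteq> {}"
  shows "2 * perimeter (midpoints K L) \<le> perimeter K + perimeter L"
proof -
  have approx: "2 * perimeter (midpoints K L) \<le> ennreal (1 + e) * (perimeter K + perimeter L)"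
    if e: "0 < e" for e
  proof -
    obtain P where P: "polytope P" "K \<subseteq> P" "perimeter P \<le> ennreal (1 + e) * perimeter K"
      using circumscribed_polytope[OF K e] unfolding perimeter_def by metis
    obtain Q where Q: "polytope Q" "L \<subseteq> Q" "perimeter Q \<le> ennreal (1 + e) * perimeter L"
      using circumscribed_polytope[OF L e] unfolding perimeter_def by metis
    have int: "interior P \<noteq> {}" "interior Q \<noteq> {}"
      using K(3) L(3) interior_mono[OF P(2)] interior_mono[OF Q(2)] by blast+
    have "bounded (midpoints P Q)"
      using P Q by (intro compact_imp_bounded compact_midpoints polytope_imp_compact)
    then have "perimeter (midpoints K L) \<le> perimeter (midpoints P Q)"
      unfolding perimeter_def using K L P Q
      by (intro hausdorff_measure1_frontier_mono midpoints_mono)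
         (auto intro: convex_midpoints compact_imp_closed compact_midpoints)
    then have "2 * perimeter (midpoints K L) \<le> 2 * perimeter (midpoints P Q)" by (rule mult_left_mono) simp
    also have "\<dots> \<le> perimeter P + perimeter Q"
      by (rule perimeter_midpoints_polytope[OF P(1) int(1) Q(1) int(2)])
    also have "\<dots> \<le> ennreal (1 + e) * perimeter K + ennreal (1 + e) * perimeter L"
      using P(3) Q(3) by (rule add_mono)
    finally show ?thesis by (simp add: distrib_left)
  qed
  obtain s where s: "0 \<le> s" "perimeter K + perimeter L = ennreal s"
    using perimeter_finite[OF K] perimeter_finite[OF L] by (metis ennreal_add_less_top less_top_ennreal)
  have "2 * perimeter (midpoints K L) \<le> ennreal s + ennreal d" if d: "0 < d" for d
  proof -
    \<comment> \<open>\<open>s + 1\<close> instead of \<open>s\<close> avoids dividing by zero.\<close>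
    have "0 < d / (s + 1)" using s d by simp
    from approx[OF this] have "2 * perimeter (midpoints K L) \<le> ennreal ((1 + d / (s + 1)) * s)"
      using s d by (simp add: ennreal_mult)
    also have "\<dots> \<le> ennreal (s + d)"
    proof (rule ennreal_leI)
      have "d * s \<le> d * (s + 1)" using d by (intro mult_left_mono) auto
      then have "d / (s + 1) * s \<le> d" using s by (simp add: field_simps)
      then show "(1 + d / (s + 1)) * s \<le> s + d" by (simp add: distrib_right)
    qed
    finally show ?thesis using s d by simp
  qed
  then show ?thesis unfolding s(2) by (rule ennreal_le_epsilon)
qed

section \<open>Equality in the Brunn--Minkowski inequality on the line\<close>

text \<open>\<open>X s\<close> is the point to the left of which \<open>f\<close> has mass \<open>s\<close>, the inverse of the distribution function.
  Continuity of \<open>f\<close> is asked for only in the open interval, because the section lengths of a convex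
  body are seen there to be continuous as differences of concave and convex functions.\<close>

lemma quantile_function:
  fixes f :: "real \<Rightarrow> real" and a b :: real
  defines "A \<equiv> integral {a..b} f"
  assumes "a < b" and f_int: "f integrable_on {a..b}" and f_cont: "continuous_on {a<..<b} f"
    and f_pos: "\<And>x. a < x \<Longrightarrow> x < b \<Longrightarrow> 0 < f x"
  obtains X where "0 < A" "continuous_on {0..A} X" "X 0 = a" "X A = b"
    "\<forall>s. 0 < s \<and> s < A \<longrightarrow> a < X s \<and> X s < b \<and> (X has_real_derivative 1 / f (X s)) (at s)"
proof -
  define F where "F = (\<lambda>x. integral {a..x} f)"
  have F_cont: "continuous_on {a..b} F"
    unfolding F_def by (rule indefinite_integral_continuous_1[OF f_int])
  have F_deriv: "(F has_real_derivative f x) (at x)" if x: "a < x" "x < b" for x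
  proof -
    have "isCont f x" using f_cont x by (simp add: continuous_on_eq_continuous_at)
    then have "continuous (at x within {a..b}) f" by (rule continuous_at_imp_continuous_at_within)
    then have "(F has_vector_derivative f x) (at x within {a..b})"
      using integral_has_vector_derivative_continuous_at[OF f_int, of x "{}"] x by (simp add: F_def)
    then show ?thesis
      using x by (simp add: at_within_Icc_at has_real_derivative_iff_has_vector_derivative)
  qed
  have F_mono: "F x < F y" if "a \<le> x" "x < y" "y \<le> b" for x y
  proof (rule DERIV_pos_imp_increasing_open[OF \<open>x < y\<close>])
    show "\<exists>D. (F has_real_derivative D) (at z) \<and> 0 < D" if "x < z" "z < y" for z
      using F_deriv[of z] f_pos[of z] \<open>a \<le> x\<close> \<open>y \<le> b\<close> that by auto
    show "continuous_on {x..y} F" using F_cont by (rule continuous_on_subset) (use that in auto)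
  qed
  have F_ends: "F a = 0" "F b = A" by (simp_all add: F_def A_def)
  have inj: "inj_on F {a..b}"
    by (rule linorder_inj_onI) (use F_mono in force)+
  have image: "F ` {a..b} = {0..A}"
  proof (intro subset_antisym subsetI)
    fix y assume "y \<in> F ` {a..b}"
    then obtain x where "a \<le> x" "x \<le> b" "y = F x" by auto
    then show "y \<in> {0..A}" using F_mono[of a x] F_mono[of x b] F_ends by (cases "x = a"; cases "x = b"; force)
  next
    fix y assume "y \<in> {0..A}"
    then obtain x where "a \<le> x" "x \<le> b" "F x = y"
      using IVT'[of F a y b] F_ends F_cont \<open>a < b\<close> by auto
    then show "y \<in> F ` {a..b}" by auto
  qed
  define X where "X = the_inv_into {a..b} F"
  have X_cont: "continuous_on {0..A} X"
    using continuous_on_inv_into[OF F_cont compact_Icc inj] by (simp add: image X_def)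
  have X_mem: "X s \<in> {a..b}" and FX: "F (X s) = s" if "s \<in> {0..A}" for s
    using the_inv_into_into[OF inj _ subset_refl, of s] f_the_inv_into_f[OF inj, of s] that
    unfolding image X_def by auto
  have XF: "X (F x) = x" if "x \<in> {a..b}" for x
    using the_inv_into_f_f[OF inj that] by (simp add: X_def)
  have "0 < A" using F_mono[of a b] F_ends \<open>a < b\<close> by simp
  have X_ends: "X 0 = a" "X A = b" using XF[of a] XF[of b] F_ends \<open>a < b\<close> by auto
  have X_in: "a < X s \<and> X s < b" if "0 < s" "s < A" for s
    using X_mem[of s] FX[of s] F_ends that by (cases "X s = a"; cases "X s = b"; force)
  have "(X has_real_derivative 1 / f (X s)) (at s)" if s: "0 < s" "s < A" for s
  proof -
    have "(X has_real_derivative inverse (f (X s))) (at s)"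
    proof (rule DERIV_inverse_function[where f = F and a = 0 and b = A])
      show "isCont X s" using X_cont s by (simp add: continuous_on_interior)
      show "f (X s) \<noteq> 0" using f_pos[of "X s"] X_in[OF s] by auto
    qed (use s X_in[OF s] F_deriv FX in auto)
    then show ?thesis by (simp add: inverse_eq_divide)
  qed
  then have "\<forall>s. 0 < s \<and> s < A \<longrightarrow> a < X s \<and> X s < b \<and> (X has_real_derivative 1 / f (X s)) (at s)"
    using X_in by simp
  with \<open>0 < A\<close> X_cont X_ends show ?thesis by (rule that)
qed

text \<open>The one-dimensional core of the Brunn--Minkowski inequality. Match the points \<open>X s\<close> and \<open>Y s\<close> at
  which \<open>f\<close> and \<open>g\<close> have accumulated the same mass \<open>s\<close>. The mass that \<open>l\<close> has accumulated at their
  midpoint grows at rate at least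
  \<open>(f + g)/2 * (1/f + 1/g)/2 = 1 + (f - g)\<^sup>2/(4 f g)\<close>. As the total mass of \<open>l\<close> is at most that of \<open>f\<close>,
  the rate is constantly 1, so \<open>f (X s) = g (Y s)\<close>; then \<open>X\<close> and \<open>Y\<close> have the same derivative and
  differ by a constant \<open>e\<close>.\<close>

lemma mean_profile_equality:
  fixes f g l :: "real \<Rightarrow> real"
  assumes "a < b" and f_int: "(f has_integral A) {a..b}" and f_cont: "continuous_on {a<..<b} f"
    and f_pos: "\<And>x. a < x \<Longrightarrow> x < b \<Longrightarrow> 0 < f x"
    and "c < d" and g_int: "(g has_integral A) {c..d}" and g_cont: "continuous_on {c<..<d} g"
    and g_pos: "\<And>y. c < y \<Longrightarrow> y < d \<Longrightarrow> 0 < g y"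
    and l_int: "(l has_integral B) {(a + c) / 2..(b + d) / 2}"
    and l_cont: "continuous_on {(a + c) / 2<..<(b + d) / 2} l" and "B \<le> A"
    and mean_le: "\<And>x y. a < x \<Longrightarrow> x < b \<Longrightarrow> c < y \<Longrightarrow> y < d \<Longrightarrow> (f x + g y) / 2 \<le> l ((x + y) / 2)"
  obtains e where "c = a + e" "d = b + e"
    "\<And>x. a < x \<Longrightarrow> x < b \<Longrightarrow> g (x + e) = f x \<and> l (x + e / 2) = f x"
proof -
  have A: "integral {a..b} f = A" "integral {c..d} g = A" using f_int g_int by auto
  obtain X where "0 < A" and X: "continuous_on {0..A} X" "X 0 = a" "X A = b"
      and X_all: "\<forall>s. 0 < s \<and> s < A \<longrightarrow> a < X s \<and> X s < b \<and> (X has_real_derivative 1 / f (X s)) (at s)"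
    by (rule quantile_function[OF \<open>a < b\<close> has_integral_integrable[OF f_int] f_cont f_pos, unfolded A])
  obtain Y where Y: "continuous_on {0..A} Y" "Y 0 = c" "Y A = d"
      and Y_all: "\<forall>s. 0 < s \<and> s < A \<longrightarrow> c < Y s \<and> Y s < d \<and> (Y has_real_derivative 1 / g (Y s)) (at s)"
    by (rule quantile_function[OF \<open>c < d\<close> has_integral_integrable[OF g_int] g_cont g_pos, unfolded A])
  have X_in: "a < X s \<and> X s < b" and X_deriv: "(X has_real_derivative 1 / f (X s)) (at s)"
    and Y_in: "c < Y s \<and> Y s < d" and Y_deriv: "(Y has_real_derivative 1 / g (Y s)) (at s)"
    if "0 < s" "s < A" for s
    using X_all Y_all that by simp_all
  define m where "m s = (X s + Y s) / 2" for s
  define G where "G = (\<lambda>z. integral {(a + c) / 2..z} l)"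
  define H where "H s = G (m s) - s" for s
  have m_cont: "continuous_on {0..A} m" unfolding m_def by (intro continuous_intros X Y) auto
  have m_in: "(a + c) / 2 < m s" "m s < (b + d) / 2" if "0 < s" "s < A" for s
    using X_in[OF that] Y_in[OF that] by (auto simp: m_def)
  have m_ends: "m 0 = (a + c) / 2" "m A = (b + d) / 2" by (simp_all add: m_def X Y)
  have "m ` {0..A} \<subseteq> {(a + c) / 2..(b + d) / 2}"
  proof
    fix z assume "z \<in> m ` {0..A}"
    then obtain s where s: "0 \<le> s" "s \<le> A" "z = m s" by auto
    consider "s = 0" | "s = A" | "0 < s" "s < A" using s by force
    then show "z \<in> {(a + c) / 2..(b + d) / 2}"
      using m_ends m_in[of s] s \<open>a < b\<close> \<open>c < d\<close> by cases auto
  qed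
  moreover have "continuous_on {(a + c) / 2..(b + d) / 2} G"
    unfolding G_def by (rule indefinite_integral_continuous_1[OF has_integral_integrable[OF l_int]])
  ultimately have H_cont: "continuous_on {0..A} H"
    unfolding H_def using m_cont by (intro continuous_intros continuous_on_compose2[where f = m and g = G])
  define D where "D s = l (m s) * ((1 / f (X s) + 1 / g (Y s)) / 2) - 1" for s
  have H_deriv: "(H has_real_derivative D s) (at s)" if s: "0 < s" "s < A" for s
  proof -
    have "isCont l (m s)" using l_cont m_in[OF s] by (simp add: continuous_on_eq_continuous_at)
    then have "continuous (at (m s) within {(a + c) / 2..(b + d) / 2}) l"
      by (rule continuous_at_imp_continuous_at_within)
    then have "(G has_vector_derivative l (m s)) (at (m s) within {(a + c) / 2..(b + d) / 2})"
      using integral_has_vector_derivative_continuous_at[OF has_integral_integrable[OF l_int], of "m s" "{}"]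
        m_in[OF s] by (simp add: G_def)
    then have "(G has_real_derivative l (m s)) (at (m s))"
      using m_in[OF s] by (simp add: at_within_Icc_at has_real_derivative_iff_has_vector_derivative)
    moreover have "(m has_real_derivative (1 / f (X s) + 1 / g (Y s)) / 2) (at s)"
      unfolding m_def using X_deriv[OF s] Y_deriv[OF s] by (intro DERIV_cdivide DERIV_add)
    ultimately show ?thesis
      unfolding H_def D_def by (intro DERIV_diff DERIV_ident DERIV_chain2[where f = G])
  qed
  have mean: "(f (X s) + g (Y s)) / 2 \<le> l (m s)" and pos: "0 < f (X s)" "0 < g (Y s)"
    if "0 < s" "s < A" for s
    using mean_le[of "X s" "Y s"] f_pos[of "X s"] g_pos[of "Y s"] X_in[OF that] Y_in[OF that]
    by (simp_all add: m_def)
  have D_nonneg: "0 \<le> D s" if s: "0 < s" "s < A" for s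
  proof -
    define p q where "p = f (X s)" and "q = g (Y s)"
    have pq: "0 < p" "0 < q" using pos[OF s] by (simp_all add: p_def q_def)
    have "0 \<le> (p - q)\<^sup>2 / (4 * p * q)" using pq by simp
    also have "\<dots> = (p + q) / 2 * ((1 / p + 1 / q) / 2) - 1"
      using pq by (simp add: field_simps power2_eq_square)
    also have "\<dots> \<le> l (m s) * ((1 / p + 1 / q) / 2) - 1"
      using mean[OF s] pq unfolding p_def[symmetric] q_def[symmetric]
      by (intro diff_right_mono mult_right_mono) auto
    finally show ?thesis by (simp add: D_def p_def q_def)
  qed
  have H_mono: "H s \<le> H t" if "0 \<le> s" "s \<le> t" "t \<le> A" for s t
  proof (rule DERIV_nonneg_imp_increasing_open[OF \<open>s \<le> t\<close>])
    show "\<exists>y. (H has_real_derivative y) (at x) \<and> 0 \<le> y" if "s < x" "x < t" for x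
      using H_deriv[of x] D_nonneg[of x] \<open>0 \<le> s\<close> \<open>t \<le> A\<close> that by auto
    show "continuous_on {s..t} H" using H_cont by (rule continuous_on_subset) (use that in auto)
  qed
  \<comment> \<open>\<open>H\<close> is the surplus mass of \<open>l\<close>; it increases from 0 to at most 0.\<close>
  have "H 0 = 0" "H A \<le> 0" using \<open>B \<le> A\<close> integral_unique[OF l_int] by (simp_all add: H_def m_ends G_def)
  then have H_zero: "H s = 0" if "0 < s" "s < A" for s
    using H_mono[of 0 s] H_mono[of s A] that by auto
  have eq: "f (X s) = g (Y s) \<and> l (m s) = f (X s)" if s: "0 < s" "s < A" for s
  proof -
    have "((\<lambda>_. 0) has_real_derivative D s) (at s)"
      using has_field_derivative_transform_within_open[OF H_deriv[OF s], of "{0<..<A}" "\<lambda>_. 0"] s H_zero by auto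
    then have "D s = 0" using DERIV_unique DERIV_const by blast
    define p q where "p = f (X s)" and "q = g (Y s)"
    have pq: "0 < p" "0 < q" using pos[OF s] by (simp_all add: p_def q_def)
    have l: "l (m s) * (p + q) = 2 * p * q"
      using \<open>D s = 0\<close> pq unfolding D_def p_def[symmetric] q_def[symmetric] by (simp add: field_simps)
    have "(p + q) / 2 * (p + q) \<le> l (m s) * (p + q)"
      using mean[OF s] pq unfolding p_def[symmetric] q_def[symmetric] by (intro mult_right_mono) auto
    then have "(p - q)\<^sup>2 \<le> 0" unfolding l by (simp add: power2_eq_square field_simps)
    then have "p = q" by simp
    moreover have "l (m s) = p" using l pq unfolding \<open>p = q\<close> by simp
    ultimately show ?thesis by (simp add: p_def q_def)
  qed
  define e where "e = c - a"
  have Y_eq: "Y s = X s + e" if "0 \<le> s" "s \<le> A" for s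
  proof -
    have "Y s - X s = Y 0 - X 0"
    proof (rule DERIV_isconst2[OF \<open>0 < A\<close> _ _ that])
      show "continuous_on {0..A} (\<lambda>s. Y s - X s)" by (intro continuous_intros X Y)
      show "((\<lambda>s. Y s - X s) has_real_derivative 0) (at t)" if "0 < t" "t < A" for t
        using DERIV_diff[OF Y_deriv X_deriv, OF that that] eq[OF that] by simp
    qed
    then show ?thesis by (simp add: X Y e_def)
  qed
  have "d = b + e" using Y_eq[of A] \<open>0 < A\<close> X Y by simp
  moreover have "g (x + e) = f x \<and> l (x + e / 2) = f x" if x: "a < x" "x < b" for x
  proof -
    obtain s where s: "0 \<le> s" "s \<le> A" "X s = x" using IVT'[of X 0 x A] X x \<open>0 < A\<close> by auto
    then have "0 < s" "s < A" using X x by (force simp: less_le)+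
    moreover have "m s = x + e / 2" using Y_eq[OF s(1,2)] s(3) by (simp add: m_def field_simps)
    ultimately show ?thesis using eq[of s] Y_eq[of s] s by simp
  qed
  moreover have "c = a + e" by (simp add: e_def)
  ultimately show ?thesis using that[of e] by blast
qed

text \<open>Read the hypothesis as \<open>\<phi> x - \<phi> m \<le> \<psi> m - \<psi> y\<close> with \<open>m\<close> the midpoint: an increment of \<open>\<phi>\<close> is at most
  the preceding increment of \<open>\<psi>\<close> over a step of the same length. Summing over a subdivision with
  \<open>n\<close> steps leaves a shift by one step, which disappears as \<open>n\<close> grows. Applied twice, with
  the roles of \<open>\<phi>\<close> and \<open>\<psi>\<close> exchanged, it shows that \<open>\<psi> - \<phi>\<close> is constant.\<close>

lemma midpoint_exchange_half:
  fixes \<phi> \<psi> :: "real \<Rightarrow> real"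
  assumes cont: "continuous_on {a<..<b} \<phi>" "continuous_on {a<..<b} \<psi>"
    and ex: "\<And>x y. a < x \<Longrightarrow> x < b \<Longrightarrow> a < y \<Longrightarrow> y < b \<Longrightarrow>
      \<phi> x + \<psi> y \<le> \<phi> ((x + y) / 2) + \<psi> ((x + y) / 2)"
    and pq: "a < p" "p < q" "q < b"
  shows "\<phi> q - \<phi> p \<le> \<psi> q - \<psi> p"
proof -
  define h where "h n = (q - p) / real (Suc n)" for n
  have h_pos: "0 < h n" for n using pq by (simp add: h_def)
  have step: "\<phi> q - \<phi> (p + h n) \<le> \<psi> (q - h n) - \<psi> p" for n
  proof -
    define x where "x i = p + real i * h n" for i
    have x_end: "x (Suc n) = q" by (simp add: x_def h_def)
    have x_in: "a < x i \<and> x i < b" if "i \<le> Suc n" for i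
    proof -
      have "real i * h n \<le> real (Suc n) * h n" using h_pos[of n] that by (intro mult_right_mono) auto
      then have "x i \<le> q" using x_end by (simp add: x_def)
      moreover have "p \<le> x i" using h_pos[of n] by (simp add: x_def)
      ultimately show ?thesis using pq by auto
    qed
    have "\<phi> (x (Suc (Suc i))) - \<phi> (x (Suc i)) \<le> \<psi> (x (Suc i)) - \<psi> (x i)" if "i < n" for i
    proof -
      have "(x (Suc (Suc i)) + x i) / 2 = x (Suc i)" by (simp add: x_def field_simps)
      then show ?thesis using ex[of "x (Suc (Suc i))" "x i"] x_in[of i] x_in[of "Suc (Suc i)"] that by auto
    qed
    then have "(\<Sum>i<n. \<phi> (x (Suc (Suc i))) - \<phi> (x (Suc i))) \<le> (\<Sum>i<n. \<psi> (x (Suc i)) - \<psi> (x i))"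
      by (intro sum_mono) auto
    then have "\<phi> (x (Suc n)) - \<phi> (x 1) \<le> \<psi> (x n) - \<psi> (x 0)"
      using sum_lessThan_telescope[of "\<lambda>i. \<phi> (x (Suc i))" n] sum_lessThan_telescope[of "\<lambda>i. \<psi> (x i)" n] by simp
    moreover have "x n = q - h n" using x_end by (simp add: x_def algebra_simps)
    moreover have "x 1 = p + h n" "x 0 = p" by (simp_all add: x_def)
    ultimately show ?thesis using x_end by simp
  qed
  have "h \<longlonglongrightarrow> 0" unfolding h_def using LIMSEQ_Suc[OF lim_const_over_n] by blast
  then have h1: "(\<lambda>n. p + h n) \<longlonglongrightarrow> p" and h2: "(\<lambda>n. q - h n) \<longlonglongrightarrow> q"
    by (auto intro!: tendsto_eq_intros)
  have iso: "isCont \<phi> p" "isCont \<psi> q"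
    using cont pq by (simp_all add: continuous_on_eq_continuous_at)
  have "(\<lambda>n. \<phi> q - \<phi> (p + h n)) \<longlonglongrightarrow> \<phi> q - \<phi> p"
    using isCont_tendsto_compose[OF iso(1) h1] by (intro tendsto_intros)
  moreover have "(\<lambda>n. \<psi> (q - h n) - \<psi> p) \<longlonglongrightarrow> \<psi> q - \<psi> p"
    using isCont_tendsto_compose[OF iso(2) h2] by (intro tendsto_intros)
  ultimately show ?thesis by (rule LIMSEQ_le) (use step in auto)
qed

lemma midpoint_exchange_const_diff:
  fixes \<phi> \<psi> :: "real \<Rightarrow> real"
  assumes cont: "continuous_on {a<..<b} \<phi>" "continuous_on {a<..<b} \<psi>"
    and ex: "\<And>x y. a < x \<Longrightarrow> x < b \<Longrightarrow> a < y \<Longrightarrow> y < b \<Longrightarrow>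
      \<phi> x + \<psi> y \<le> \<phi> ((x + y) / 2) + \<psi> ((x + y) / 2)"
  obtains v where "\<And>x. a < x \<Longrightarrow> x < b \<Longrightarrow> \<psi> x = \<phi> x + v"
proof -
  have ex': "\<psi> x + \<phi> y \<le> \<psi> ((x + y) / 2) + \<phi> ((x + y) / 2)" if "a < x" "x < b" "a < y" "y < b" for x y
    using ex[OF that(3,4,1,2)] by (simp add: add.commute)
  have le: "\<psi> q - \<phi> q = \<psi> p - \<phi> p" if "a < p" "p < q" "q < b" for p q
    using midpoint_exchange_half[OF cont ex that] midpoint_exchange_half[OF cont(2,1) ex' that] by simp
  define v where "v = \<psi> ((a + b) / 2) - \<phi> ((a + b) / 2)"
  have "\<psi> x = \<phi> x + v" if "a < x" "x < b" for x
  proof (cases x "(a + b) / 2" rule: linorder_cases)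
    case less
    then show ?thesis using le[of x "(a + b) / 2"] that by (simp add: v_def)
  next
    case equal
    then show ?thesis unfolding v_def equal by simp
  next
    case greater
    then show ?thesis using le[of "(a + b) / 2" x] that by (simp add: v_def)
  qed
  then show ?thesis using that by blast
qed

section \<open>Vertical sections of convex bodies\<close>

definition sec_top :: "(real \<times> real) set \<Rightarrow> real \<Rightarrow> real" where
  "sec_top K x = Sup (Pair x -` K)"

definition sec_bot :: "(real \<times> real) set \<Rightarrow> real \<Rightarrow> real" where
  "sec_bot K x = Inf (Pair x -` K)"

definition sec_length :: "(real \<times> real) set \<Rightarrow> real \<Rightarrow> real" where
  "sec_length K x = measure lborel (Pair x -` K)"

lemma compact_vertical_section:
  fixes K :: "(real \<times> real) set"
  assumes "compact K" shows "compact (Pair x -` K)"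
proof -
  have "Pair x -` K = snd ` (K \<inter> {x} \<times> UNIV)" by force
  moreover have "compact (K \<inter> {x} \<times> UNIV)"
    using assms by (intro compact_Int_closed closed_Times) auto
  ultimately show ?thesis by (simp add: compact_continuous_image continuous_on_snd continuous_on_id)
qed

lemma section_bounds:
  assumes "compact K" "(x, y) \<in> K"
  shows "y \<le> sec_top K x" "sec_bot K x \<le> y"
  using compact_vertical_section[OF assms(1), of x] assms(2)
  by (auto simp: sec_top_def sec_bot_def intro!: cSup_upper cInf_lower
      intro: bounded_imp_bdd_above bounded_imp_bdd_below compact_imp_bounded)

lemma section_ends:
  assumes "compact K" "x \<in> fst ` K"
  shows "(x, sec_top K x) \<in> K" "(x, sec_bot K x) \<in> K"
proof -
  have c: "compact (Pair x -` K)" and ne: "Pair x -` K \<noteq> {}"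
    using compact_vertical_section[OF assms(1)] assms(2) by auto
  have "Sup (Pair x -` K) \<in> Pair x -` K"
    using c ne by (intro closed_contains_Sup) (auto intro: compact_imp_closed bounded_imp_bdd_above compact_imp_bounded)
  then show "(x, sec_top K x) \<in> K" by (simp add: sec_top_def)
  have "Inf (Pair x -` K) \<in> Pair x -` K"
    using c ne by (intro closed_contains_Inf) (auto intro: compact_imp_closed bounded_imp_bdd_below compact_imp_bounded)
  then show "(x, sec_bot K x) \<in> K" by (simp add: sec_bot_def)
qed

lemma section_interval:
  assumes "compact K" "convex K" "x \<in> fst ` K"
  shows "Pair x -` K = {sec_bot K x..sec_top K x}"
proof
  show "Pair x -` K \<subseteq> {sec_bot K x..sec_top K x}" using section_bounds[OF assms(1)] by auto
  show "{sec_bot K x..sec_top K x} \<subseteq> Pair x -` K"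
  proof
    fix y assume "y \<in> {sec_bot K x..sec_top K x}"
    then have "y \<in> closed_segment (sec_bot K x) (sec_top K x)" by (auto simp: closed_segment_eq_real_ivl)
    then have "(x, y) \<in> closed_segment (x, sec_bot K x) (x, sec_top K x)"
      by (auto simp: closed_segment_def algebra_simps)
    then show "y \<in> Pair x -` K"
      using closed_segment_subset[OF section_ends(2,1)[OF assms(1,3)] assms(2)] by auto
  qed
qed

lemma sec_length_eq:
  assumes "compact K" "convex K" "x \<in> fst ` K"
  shows "sec_length K x = sec_top K x - sec_bot K x"
  using section_interval[OF assms] section_bounds[OF assms(1) section_ends(1)[OF assms(1,3)]]
  by (simp add: sec_length_def)

lemma sec_length_outside: "x \<notin> fst ` K \<Longrightarrow> sec_length K x = 0"
proof -
  assume "x \<notin> fst ` K"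
  then have "Pair x -` K = {}" by force
  then show ?thesis by (simp add: sec_length_def)
qed

lemma section_ends_concave_convex:
  assumes K: "compact K" "convex K" and S: "convex S" "S \<subseteq> fst ` K"
  shows "concave_on S (sec_top K)" "convex_on S (sec_bot K)"
proof -
  have comb: "((1 - t) * x + t * y, (1 - t) * p + t * q) \<in> K"
    if "0 < t" "t < 1" "(x, p) \<in> K" "(y, q) \<in> K" for t x y p q
    using convexD[OF K(2) that(3,4), of "1 - t" t] that by simp
  show "concave_on S (sec_top K)"
    unfolding concave_on_def
  proof (rule convex_onI[OF _ S(1)])
    fix t x y :: real assume t: "0 < t" "t < 1" and "x \<in> S" "y \<in> S"
    then have "(x, sec_top K x) \<in> K" "(y, sec_top K y) \<in> K" using S section_ends[OF K(1)] by blast+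
    from section_bounds(1)[OF K(1) comb[OF t this]]
    show "- sec_top K ((1 - t) *\<^sub>R x + t *\<^sub>R y) \<le> (1 - t) * - sec_top K x + t * - sec_top K y"
      by simp
  qed
  show "convex_on S (sec_bot K)"
  proof (rule convex_onI[OF _ S(1)])
    fix t x y :: real assume t: "0 < t" "t < 1" and "x \<in> S" "y \<in> S"
    then have "(x, sec_bot K x) \<in> K" "(y, sec_bot K y) \<in> K" using S section_ends[OF K(1)] by blast+
    from section_bounds(2)[OF K(1) comb[OF t this]]
    show "sec_bot K ((1 - t) *\<^sub>R x + t *\<^sub>R y) \<le> (1 - t) * sec_bot K x + t * sec_bot K y"
      by simp
  qed
qed

text \<open>Cavalieri's principle, put in terms of the Henstock--Kurzweil integral in order to apply the
  fundamental theorem of calculus.\<close>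

lemma sec_length_has_integral:
  fixes K :: "(real \<times> real) set"
  assumes K: "compact K" "convex K" and ab: "fst ` K = {a..b}"
  shows "(sec_length K has_integral measure lborel K) {a..b}"
proof -
  have "K \<in> sets lborel" using K(1) by (simp add: compact_imp_closed borel_closed)
  then have K_sets: "K \<in> sets (lborel \<Otimes>\<^sub>M lborel)" unfolding lborel_prod .
  have fin: "emeasure lborel (Pair x -` K) = ennreal (sec_length K x)" for x
    using emeasure_compact_finite[OF compact_vertical_section[OF K(1)], of x]
    by (simp add: sec_length_def emeasure_eq_ennreal_measure top.not_eq_extremum)
  have "emeasure lborel K = (\<integral>\<^sup>+x. ennreal (sec_length K x) \<partial>lborel)"
    using lborel.emeasure_pair_measure_alt[OF K_sets] by (simp add: lborel_prod fin)
  moreover have "emeasure lborel K = ennreal (measure lborel K)"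
    using emeasure_compact_finite[OF K(1)] by (intro emeasure_eq_ennreal_measure) auto
  moreover have "sec_length K \<in> borel_measurable borel"
  proof -
    have "(\<lambda>x. emeasure lborel (Pair x -` K)) \<in> borel_measurable lborel"
      by (rule lborel.measurable_emeasure_Pair[OF K_sets])
    then have "(\<lambda>x. enn2real (emeasure lborel (Pair x -` K))) \<in> borel_measurable lborel"
      by measurable
    then show ?thesis by (simp add: sec_length_def[abs_def] measure_def)
  qed
  ultimately have "(sec_length K has_integral measure lborel K) UNIV"
    by (intro nn_integral_has_integral) (auto simp: sec_length_def)
  moreover have "(\<lambda>x. if x \<in> {a..b} then sec_length K x else 0) = sec_length K"
    using sec_length_outside[of _ K] ab by auto
  ultimately show ?thesis using has_integral_restrict_UNIV[of "{a..b}" "sec_length K"] by simp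
qed

text \<open>The open range of the interior is where section lengths are positive and continuous.\<close>

lemma section_range:
  fixes K :: "(real \<times> real) set"
  assumes K: "compact K" "convex K" "interior K \<noteq> {}"
  obtains a b where "a < b" "fst ` K = {a..b}" "fst ` interior K = {a<..<b}"
proof -
  have ne: "K \<noteq> {}" using K(3) by auto
  have "compact (fst ` K)" "convex (fst ` K)"
    using compact_continuous_image[OF continuous_on_fst[OF continuous_on_id] K(1)]
      convex_linear_image[OF linear_fst K(2)] by auto
  then obtain a b where ab: "fst ` K = {a..b}"
    using connected_compact_interval_1[of "fst ` K"] convex_connected by auto
  have o: "open (fst ` interior K)" by (intro open_surjective_linear_image linear_fst open_interior) simp
  have conv: "convex (fst ` interior K)" by (intro convex_linear_image linear_fst convex_interior K)
  have "fst ` interior K \<subseteq> interior {a..b}" using o interior_subset by (intro interior_maximal) (auto simp flip: ab)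
  then have 1: "fst ` interior K \<subseteq> {a<..<b}" by simp
  \<comment> \<open>The projection of the interior is dense in \<open>{a..b}\<close>, and a convex set has the same interior as its closure.\<close>
  have "{a..b} = fst ` closure (interior K)"
    using convex_closure_interior[OF K(2,3)] K(1) ab by (simp add: compact_imp_closed)
  also have "\<dots> \<subseteq> closure (fst ` interior K)"
    by (rule image_closure_subset) (auto intro: continuous_on_fst continuous_on_id closure_subset[THEN subsetD])
  finally have "interior {a..b} \<subseteq> interior (closure (fst ` interior K))" by (rule interior_mono)
  also have "\<dots> = fst ` interior K" using convex_interior_closure[OF conv] o by (simp add: interior_open)
  finally have "{a<..<b} \<subseteq> fst ` interior K" by simp
  with 1 have "fst ` interior K = {a<..<b}" by (rule subset_antisym)
  moreover have "a < b" using 1 K(3) by force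
  ultimately show ?thesis using that ab by blast
qed

lemma sec_length_pos:
  assumes K: "compact K" "convex K" and x: "x \<in> fst ` interior K"
  shows "0 < sec_length K x"
proof -
  obtain y where "(x, y) \<in> interior K" using x by auto
  then obtain r where r: "0 < r" "ball (x, y) r \<subseteq> K" using mem_interior by blast
  have "(x, y + r / 2) \<in> ball (x, y) r" "(x, y) \<in> ball (x, y) r" using r(1) by (auto simp: dist_Pair_Pair dist_real_def)
  then have "(x, y + r / 2) \<in> K" "(x, y) \<in> K" using r(2) by auto
  from section_bounds(1)[OF K(1) this(1)] section_bounds(2)[OF K(1) this(2)] this(2)
  show ?thesis using r(1) sec_length_eq[OF K, of x] by (force simp: image_iff)
qed

lemma section_functions_continuous:
  assumes K: "compact K" "convex K" and ab: "{a<..<b} \<subseteq> fst ` K"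
  shows "continuous_on {a<..<b} (sec_top K)" "continuous_on {a<..<b} (sec_bot K)"
    "continuous_on {a<..<b} (sec_length K)"
proof -
  have conv: "concave_on {a<..<b} (sec_top K)" "convex_on {a<..<b} (sec_bot K)"
    using section_ends_concave_convex[OF K _ ab] by auto
  show bot: "continuous_on {a<..<b} (sec_bot K)" using conv by (intro convex_on_continuous) auto
  have "continuous_on {a<..<b} (\<lambda>x. - sec_top K x)"
    using conv unfolding concave_on_def by (intro convex_on_continuous) auto
  from continuous_on_minus[OF this] show top: "continuous_on {a<..<b} (sec_top K)" by simp
  have "continuous_on {a<..<b} (\<lambda>x. sec_top K x - sec_bot K x)" using top bot by (rule continuous_on_diff)
  then show "continuous_on {a<..<b} (sec_length K)"
  proof (rule continuous_on_eq)
    fix x assume "x \<in> {a<..<b}"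
    then have "x \<in> fst ` K" by (rule subsetD[OF ab])
    then show "sec_top K x - sec_bot K x = sec_length K x" by (simp only: sec_length_eq[OF K])
  qed
qed

lemma sections_midpoints:
  assumes K: "compact K" and L: "compact L" and x: "x \<in> fst ` K" and y: "y \<in> fst ` L"
  shows "(sec_top K x + sec_top L y) / 2 \<le> sec_top (midpoints K L) ((x + y) / 2)"
    "sec_bot (midpoints K L) ((x + y) / 2) \<le> (sec_bot K x + sec_bot L y) / 2"
proof -
  have M: "compact (midpoints K L)" using K L by (rule compact_midpoints)
  have mid: "midpoint (x, p) (y, q) = ((x + y) / 2, (p + q) / 2)" for p q :: real
    by (simp add: midpoint_def)
  show "(sec_top K x + sec_top L y) / 2 \<le> sec_top (midpoints K L) ((x + y) / 2)"
    using midpointsI[OF section_ends(1)[OF K x] section_ends(1)[OF L y]] unfolding mid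
    by (rule section_bounds(1)[OF M])
  show "sec_bot (midpoints K L) ((x + y) / 2) \<le> (sec_bot K x + sec_bot L y) / 2"
    using midpointsI[OF section_ends(2)[OF K x] section_ends(2)[OF L y]] unfolding mid
    by (rule section_bounds(2)[OF M])
qed

lemma fst_midpoints:
  fixes K L :: "(real \<times> real) set"
  assumes "fst ` K = {a..b}" "a \<le> b" "fst ` L = {c..d}" "c \<le> d" "fst ` midpoints K L = {a'..b'}"
  shows "a' = (a + c) / 2" "b' = (b + d) / 2"
proof -
  have img: "fst ` midpoints K L = {(x + y) / 2 | x y. x \<in> {a..b} \<and> y \<in> {c..d}}"
  proof -
    have "fst ` midpoints K L = {(x + y) / 2 | x y. x \<in> fst ` K \<and> y \<in> fst ` L}"
    proof (intro subset_antisym subsetI)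
      fix z assume "z \<in> fst ` midpoints K L"
      then obtain p q where "p \<in> K" "q \<in> L" "z = fst (midpoint p q)" by (auto elim: midpointsE)
      moreover from this have "z = (fst p + fst q) / 2" by (simp add: midpoint_def)
      ultimately show "z \<in> {(x + y) / 2 | x y. x \<in> fst ` K \<and> y \<in> fst ` L}" by blast
    next
      fix z assume "z \<in> {(x + y) / 2 | x y. x \<in> fst ` K \<and> y \<in> fst ` L}"
      then obtain p q where pq: "p \<in> K" "q \<in> L" "z = (fst p + fst q) / 2" by auto
      then have "z = fst (midpoint p q)" by (simp add: midpoint_def)
      then show "z \<in> fst ` midpoints K L" using midpointsI[OF pq(1,2)] by blast
    qed
    then show ?thesis using assms by simp
  qed
  have mem: "(a + c) / 2 \<in> {a'..b'}" "(b + d) / 2 \<in> {a'..b'}"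
    unfolding assms(5)[symmetric] img using assms by force+
  have bnd: "(a + c) / 2 \<le> z \<and> z \<le> (b + d) / 2" if "z \<in> {a'..b'}" for z
    using that unfolding assms(5)[symmetric] img by force
  have "a' \<in> {a'..b'}" "b' \<in> {a'..b'}" using mem by auto
  then show "a' = (a + c) / 2" "b' = (b + d) / 2" using mem bnd[of a'] bnd[of b'] by auto
qed

lemma translation_subset_of_sections:
  assumes K: "compact K" "convex K" "interior K \<noteq> {}" and L: "compact L" "convex L"
    and ends: "\<And>x. x \<in> fst ` interior K \<Longrightarrow> x + e \<in> fst ` L
      \<and> sec_top L (x + e) = sec_top K x + v \<and> sec_bot L (x + e) = sec_bot K x + v"
  shows "(+) (e, v) ` K \<subseteq> L"
proof -
  have "(+) (e, v) ` interior K \<subseteq> L"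
  proof
    fix w assume "w \<in> (+) (e, v) ` interior K"
    then obtain x y where xy: "(x, y) \<in> interior K" "w = (x + e, y + v)" by (force simp: add.commute)
    then have "(x, y) \<in> K" using interior_subset by blast
    then have "sec_bot K x \<le> y" "y \<le> sec_top K x" using section_bounds[OF K(1)] by auto
    moreover have "x \<in> fst ` interior K" using xy by force
    ultimately have "y + v \<in> Pair (x + e) -` L"
      using ends[of x] section_interval[OF L, of "x + e"] by simp
    then show "w \<in> L" using xy by simp
  qed
  then have "closure ((+) (e, v) ` interior K) \<subseteq> L" using L(1) by (simp add: closure_minimal compact_imp_closed)
  then show ?thesis
    using convex_closure_interior[OF K(2,3)] K(1) by (simp add: closure_translation compact_imp_closed)
qed

section \<open>Equality in the Brunn--Minkowski inequality in the plane\<close>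

text \<open>Equality in the one-dimensional statement makes the section of \<open>K\<close> at \<open>x\<close> and that of \<open>L\<close> at \<open>x + e\<close>
  equally long, and the section of the set of midpoints over \<open>x + e/2\<close> no longer than their average;
  so its upper end is exactly the average of the two upper ends. Averaging instead the upper ends
  at \<open>x\<close> and at \<open>y + e\<close> cannot exceed the upper end over the midpoint, and this exchange property
  forces the two upper boundaries to differ by a constant \<open>v\<close>. Equal lengths give the same \<open>v\<close> for the
  lower boundaries, so \<open>L\<close> is \<open>K\<close> moved by \<open>(e, v)\<close>.\<close>

proposition brunn_minkowski_equality_pairs:
  fixes K L :: "(real \<times> real) set"
  assumes K: "compact K" "convex K" "interior K \<noteq> {}" and L: "compact L" "convex L" "interior L \<noteq> {}"
    and area: "measure lborel K = measure lborel L" "measure lborel (midpoints K L) \<le> measure lborel K"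
  obtains v where "L = (+) v ` K"
proof -
  let ?M = "midpoints K L"
  have "L \<noteq> {}" using L(3) by auto
  then have M: "compact ?M" "convex ?M" "interior ?M \<noteq> {}"
    using compact_midpoints[OF K(1) L(1)] convex_midpoints[OF K(2) L(2)] interior_midpoints[OF K(3)] by auto
  obtain a b where ab: "a < b" "fst ` K = {a..b}" "fst ` interior K = {a<..<b}" using section_range[OF K] .
  obtain c d where cd: "c < d" "fst ` L = {c..d}" "fst ` interior L = {c<..<d}" using section_range[OF L] .
  obtain a' b' where M_ab: "a' < b'" "fst ` ?M = {a'..b'}" by (rule section_range[OF M])
  have a': "a' = (a + c) / 2" "b' = (b + d) / 2"
    using fst_midpoints[OF ab(2) _ cd(2) _ M_ab(2)] ab cd by auto
  obtain e where e: "c = a + e" "d = b + e"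
    and len: "\<And>x. a < x \<Longrightarrow> x < b \<Longrightarrow> sec_length L (x + e) = sec_length K x \<and> sec_length ?M (x + e / 2) = sec_length K x"
  proof (rule mean_profile_equality[OF ab(1) sec_length_has_integral[OF K(1,2) ab(2)] _ _ cd(1)])
    show "continuous_on {a<..<b} (sec_length K)" using ab by (intro section_functions_continuous[OF K(1,2)]) auto
    show "continuous_on {c<..<d} (sec_length L)" using cd by (intro section_functions_continuous[OF L(1,2)]) auto
    show "continuous_on {(a + c) / 2<..<(b + d) / 2} (sec_length ?M)"
      using M_ab a' by (intro section_functions_continuous[OF M(1,2)]) auto
    show "(sec_length L has_integral measure lborel K) {c..d}"
      using sec_length_has_integral[OF L(1,2) cd(2)] area by simp
    show "(sec_length ?M has_integral measure lborel ?M) {(a + c) / 2..(b + d) / 2}"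
      using sec_length_has_integral[OF M(1,2) M_ab(2)] a' by simp
    show "0 < sec_length K x" if "a < x" "x < b" for x using sec_length_pos[OF K(1,2)] ab that by simp
    show "0 < sec_length L x" if "c < x" "x < d" for x using sec_length_pos[OF L(1,2)] cd that by simp
    show "(sec_length K x + sec_length L y) / 2 \<le> sec_length ?M ((x + y) / 2)"
      if "a < x" "x < b" "c < y" "y < d" for x y
    proof -
      have x: "x \<in> fst ` K" and y: "y \<in> fst ` L" using that ab cd by auto
      have "(x + y) / 2 \<in> fst ` ?M" using that M_ab(2) a' by simp
      then show ?thesis
        using sections_midpoints[OF K(1) L(1) x y]
        by (simp add: sec_length_eq[OF K(1,2) x] sec_length_eq[OF L(1,2) y] sec_length_eq[OF M(1,2)])
    qed
  qed (use area in auto)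
  have in_K: "x \<in> fst ` K" and in_L: "x + e \<in> fst ` L" and in_M: "x + e / 2 \<in> fst ` ?M"
    if "a < x" "x < b" for x
    using that ab(2) cd(2) M_ab(2) a' e by (auto simp: field_simps)
  have top_mid: "sec_top K x + sec_top L (x + e) = 2 * sec_top ?M (x + e / 2)" if x: "a < x" "x < b" for x
  proof -
    have mid: "(x + (x + e)) / 2 = x + e / 2" by (simp add: field_simps)
    show ?thesis
      using len[OF x] sections_midpoints[OF K(1) L(1) in_K[OF x] in_L[OF x], unfolded mid]
      by (simp add: sec_length_eq[OF K(1,2) in_K[OF x]] sec_length_eq[OF L(1,2) in_L[OF x]] sec_length_eq[OF M(1,2) in_M[OF x]])
  qed
  obtain v where v: "\<And>x. a < x \<Longrightarrow> x < b \<Longrightarrow> sec_top L (x + e) = sec_top K x + v"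
  proof (rule midpoint_exchange_const_diff[of a b "sec_top K" "\<lambda>x. sec_top L (x + e)"])
    show "continuous_on {a<..<b} (sec_top K)" using ab by (intro section_functions_continuous[OF K(1,2)]) auto
    have "continuous_on {c<..<d} (sec_top L)" using cd by (intro section_functions_continuous[OF L(1,2)]) auto
    then show "continuous_on {a<..<b} (\<lambda>x. sec_top L (x + e))"
      by (rule continuous_on_compose2) (auto intro!: continuous_intros simp: e)
    show "sec_top K x + sec_top L (y + e) \<le> sec_top K ((x + y) / 2) + sec_top L ((x + y) / 2 + e)"
      if "a < x" "x < b" "a < y" "y < b" for x y
    proof -
      have mid: "(x + (y + e)) / 2 = (x + y) / 2 + e / 2" by (simp add: field_simps)
      show ?thesis
        using sections_midpoints(1)[OF K(1) L(1) in_K[OF that(1,2)] in_L[OF that(3,4)], unfolded mid]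
          top_mid[of "(x + y) / 2"] that by simp
    qed
  qed blast
  have v': "sec_bot L (x + e) = sec_bot K x + v" if x: "a < x" "x < b" for x
    using v[OF x] len[OF x] by (simp add: sec_length_eq[OF K(1,2) in_K[OF x]] sec_length_eq[OF L(1,2) in_L[OF x]])
  have KL: "(+) (e, v) ` K \<subseteq> L"
    using in_L v v' ab(3) by (intro translation_subset_of_sections[OF K L(1,2)]) auto
  have "(+) (- e, - v) ` L \<subseteq> K"
  proof (rule translation_subset_of_sections[OF L K(1,2)])
    fix y assume "y \<in> fst ` interior L"
    then have y: "a < y - e" "y - e < b" using cd(3) e by auto
    then show "y + - e \<in> fst ` K \<and> sec_top K (y + - e) = sec_top L y + - v \<and> sec_bot K (y + - e) = sec_bot L y + - v"
      using in_K[OF y] v[OF y] v'[OF y] by simp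
  qed
  then have "L \<subseteq> (+) (e, v) ` K"
    by (metis (no_types, lifting) add.right_inverse add_Pair image_mono translation_assoc translation_galois zero_prod_def image_add_0)
  with KL show ?thesis using that by blast
qed

text \<open>Vertical sections are handled through the product measure on pairs; this map carries the result
  over to vectors.\<close>

definition coords :: "real^2 \<Rightarrow> real \<times> real" where
  "coords x = (x $ 1, x $ 2)"

lemma linear_coords: "linear coords"
  by (rule linearI) (simp_all add: coords_def)

lemma bij_coords: "bij coords"
proof (rule bijI)
  show "inj coords" by (rule injI) (simp add: coords_def vec_eq_iff forall_2)
  show "surj coords" by (rule surjI[where f = "\<lambda>p. vector [fst p, snd p]"]) (simp add: coords_def)
qed

lemma measurable_coords: "coords \<in> measurable lborel borel"
  using linear_continuous_on[of coords UNIV] linear_coords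
  by (simp add: linear_linear borel_measurable_continuous_onI)

text \<open>Both measures give every box the product of its side lengths.\<close>

lemma lborel_distr_coords: "distr lborel borel coords = lborel"
proof (rule lborel_eqI[symmetric])
  fix l u :: "real \<times> real" assume lu: "\<And>b. b \<in> Basis \<Longrightarrow> l \<bullet> b \<le> u \<bullet> b"
  obtain l1 l2 u1 u2 where l: "l = (l1, l2)" and u: "u = (u1, u2)" by (cases l, cases u) auto
  have le: "l1 \<le> u1" "l2 \<le> u2" using lu[of "(1, 0)"] lu[of "(0, 1)"] by (simp_all add: l u Basis_prod_def)
  have pre: "coords -` box l u = box (vector [l1, l2]) (vector [u1, u2])"
    by (auto simp: coords_def l u mem_box_cart forall_2 mem_box Basis_prod_def ball_Un)
  have basis: "Basis = {axis 1 1, axis 2 1 :: real^2}" by (auto simp: Basis_vec_def UNIV_2)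
  have prod: "(\<Prod>b\<in>Basis. x \<bullet> b) = x $ 1 * x $ 2" for x :: "real^2"
    unfolding basis by (subst prod.insert) (simp_all add: inner_axis axis_eq_axis)
  have "emeasure (distr lborel borel coords) (box l u) = emeasure lborel (box (vector [l1, l2]) (vector [u1, u2] :: real^2))"
    by (simp add: emeasure_distr[OF measurable_coords] pre)
  also have "\<dots> = ennreal ((u1 - l1) * (u2 - l2))"
  proof -
    have "\<forall>b\<in>Basis. (vector [l1, l2] :: real^2) \<bullet> b \<le> vector [u1, u2] \<bullet> b"
      using le by (auto simp: Basis_vec_def inner_axis forall_2)
    then show ?thesis by (simp add: emeasure_lborel_box_eq prod)
  qed
  also have "\<dots> = (\<Prod>b\<in>Basis. (u - l) \<bullet> b)"
    by (simp add: l u Basis_prod_def prod.union_disjoint mult.commute)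
  finally show "emeasure (distr lborel borel coords) (box l u) = (\<Prod>b\<in>Basis. (u - l) \<bullet> b)" .
qed simp

lemma measure_coords_image:
  assumes "compact K" shows "measure lborel (coords ` K) = measure lebesgue K"
proof -
  have "compact (coords ` K)"
    using assms linear_coords by (intro compact_continuous_image linear_continuous_on) (simp_all add: linear_linear)
  then have "coords ` K \<in> sets borel" by (simp add: compact_imp_closed borel_closed)
  then have "measure lborel (coords ` K) = measure lborel (coords -` (coords ` K))"
    by (subst lborel_distr_coords[symmetric]) (simp add: measure_distr[OF measurable_coords])
  also have "coords -` (coords ` K) = K" using bij_coords by (simp add: inj_vimage_image_eq bij_is_inj)
  also have "measure lborel K = measure lebesgue K"
    using assms by (simp add: compact_imp_closed borel_closed)
  finally show ?thesis .
qed

proposition brunn_minkowski_equality: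
  fixes K L :: "(real^2) set"
  assumes K: "compact K" "convex K" "interior K \<noteq> {}" and L: "compact L" "convex L" "interior L \<noteq> {}"
    and area: "measure lebesgue K = measure lebesgue L" "measure lebesgue (midpoints K L) \<le> measure lebesgue K"
  obtains v where "L = (+) v ` K"
proof -
  have img: "compact (coords ` S)" "convex (coords ` S)" "interior (coords ` S) \<noteq> {}"
    if "compact S" "convex S" "interior S \<noteq> {}" for S
    using that linear_coords bij_coords
    by (auto intro!: compact_continuous_image linear_continuous_on convex_linear_image
        simp: linear_linear interior_bijective_linear_image)
  have mid_coords: "midpoint (coords x) (coords y) = coords (midpoint x y)" for x y
    by (simp add: coords_def midpoint_def)
  have mid: "midpoints (coords ` K) (coords ` L) = coords ` midpoints K L"
  proof (intro subset_antisym subsetI)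
    fix z assume "z \<in> midpoints (coords ` K) (coords ` L)"
    then obtain x y where "x \<in> K" "y \<in> L" "z = midpoint (coords x) (coords y)" by (auto elim: midpointsE)
    then show "z \<in> coords ` midpoints K L" unfolding mid_coords using midpointsI[of x K y L] by blast
  next
    fix z assume "z \<in> coords ` midpoints K L"
    then obtain x y where xy: "x \<in> K" "y \<in> L" "z = coords (midpoint x y)" by (auto elim: midpointsE)
    have "midpoint (coords x) (coords y) \<in> midpoints (coords ` K) (coords ` L)"
      using xy by (intro midpointsI) auto
    then show "z \<in> midpoints (coords ` K) (coords ` L)" using xy(3) mid_coords by simp
  qed
  obtain p where p: "coords ` L = (+) p ` coords ` K"
  proof (rule brunn_minkowski_equality_pairs[OF img[OF K] img[OF L]])
    show "measure lborel (coords ` K) = measure lborel (coords ` L)"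
      using area K L by (simp add: measure_coords_image)
    show "measure lborel (midpoints (coords ` K) (coords ` L)) \<le> measure lborel (coords ` K)"
      using area K L by (simp add: mid measure_coords_image compact_midpoints)
  qed
  obtain v where v: "p = coords v" using bij_coords by (metis bij_pointE)
  have "coords ` L = coords ` (+) v ` K"
    unfolding p v image_image by (simp add: linear_add[OF linear_coords])
  then have "L = (+) v ` K" using bij_coords by (simp add: inj_image_eq_iff bij_is_inj)
  then show ?thesis by (rule that)
qed

section \<open>Rotations\<close>

text \<open>The linear part of \<^const>\<open>rotation_about\<close>.\<close>

definition turn :: "real \<Rightarrow> real^2 \<Rightarrow> real^2" where
  "turn t x = vector [cos t * x $ 1 - sin t * x $ 2, sin t * x $ 1 + cos t * x $ 2]"

lemma linear_turn: "linear (turn t)"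
  by (rule linearI) (simp_all add: turn_def vec_eq_iff forall_2 algebra_simps)

lemma norm_turn: "norm (turn t x) = norm x"
proof -
  have "(cos t * a - sin t * b)\<^sup>2 + (sin t * a + cos t * b)\<^sup>2 = a\<^sup>2 + b\<^sup>2" for a b
  proof -
    have "(cos t * a - sin t * b)\<^sup>2 + (sin t * a + cos t * b)\<^sup>2 = ((sin t)\<^sup>2 + (cos t)\<^sup>2) * (a\<^sup>2 + b\<^sup>2)"
      by (simp only: power2_eq_square) algebra
    then show ?thesis by simp
  qed
  then show ?thesis by (simp add: norm_vec_def L2_set_def sum_2 turn_def)
qed

lemma orthogonal_turn: "orthogonal_transformation (turn t)"
  by (simp add: orthogonal_transformation linear_turn norm_turn)

lemma inj_turn: "inj (turn t)"
  using orthogonal_turn by (rule orthogonal_transformation_inj)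

lemma turn_fixpoint:
  assumes "cos t \<noteq> 1" "turn t x = x" shows "x = 0"
proof -
  have e: "cos t * x$1 - sin t * x$2 = x$1" "sin t * x$1 + cos t * x$2 = x$2"
    using assms(2) by (simp_all add: turn_def vec_eq_iff forall_2)
  have "(cos t - 1) * ((x$1)\<^sup>2 + (x$2)\<^sup>2)
      = x$1 * (cos t * x$1 - sin t * x$2 - x$1) + x$2 * (sin t * x$1 + cos t * x$2 - x$2)"
    by (simp add: power2_eq_square algebra_simps)
  then have "(cos t - 1) * ((x$1)\<^sup>2 + (x$2)\<^sup>2) = 0" by (simp add: e)
  then show ?thesis using assms(1) by (simp add: sum_power2_eq_zero_iff vec_eq_iff forall_2)
qed

lemma rotation_about_eq: "rotation_about p t x = (p - turn t p) + turn t x"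
  using linear_diff[OF linear_turn, of t x p] by (simp add: rotation_about_def turn_def)

lemma rotation_about_image: "rotation_about p t ` S = (+) (p - turn t p) ` turn t ` S"
  by (simp add: image_image rotation_about_eq)

lemma dist_rotation_about: "dist (rotation_about p t x) (rotation_about p t y) = dist x y"
  by (simp add: rotation_about_eq dist_norm norm_turn flip: linear_diff[OF linear_turn])

lemma perimeter_rotation_about_le: "perimeter (rotation_about p t ` S) \<le> perimeter S"
proof -
  have "frontier (rotation_about p t ` S) = rotation_about p t ` frontier S"
    by (simp only: rotation_about_image frontier_translation frontier_injective_linear_image[OF linear_turn inj_turn])
  moreover have "1-lipschitz_on (frontier S) (rotation_about p t)"
    by (rule lipschitz_onI) (simp_all add: dist_rotation_about)
  then have "hausdorff_measure1 (rotation_about p t ` frontier S) \<le> ennreal 1 * hausdorff_measure1 (frontier S)"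
    by (rule hausdorff_measure1_lipschitz_image) simp
  ultimately show ?thesis by (simp add: perimeter_def)
qed

lemma measure_rotation_about:
  assumes "S \<in> lmeasurable" shows "measure lebesgue (rotation_about p t ` S) = measure lebesgue S"
  unfolding rotation_about_image
  using measure_orthogonal_image[OF orthogonal_turn assms] by (simp add: measure_translation)

text \<open>A rotation followed by a translation is a rotation by the same angle about the point \<open>q\<close> that it
  fixes, which exists because the turn has no nonzero fixed vector. This rotation permutes the
  points of \<open>S\<close> and preserves their distances to \<open>q\<close>, so it fixes the unique point of \<open>S\<close> closest to
  \<open>q\<close>; its only fixed point is \<open>q\<close>, whence \<open>q \<in> S\<close>.\<close>

lemma rotation_about_translated_center:
  assumes S: "compact S" "convex S" "S \<noteq> {}" and t: "cos t \<noteq> 1"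
    and trans: "rotation_about p t ` S = (+) v ` S"
  obtains q where "q \<in> S" "rotation_about q t ` S = S"
proof -
  \<comment> \<open>The rotation about \<open>q\<close> is translation by \<open>h q\<close> after the turn.\<close>
  define h where "h x = x - turn t x" for x
  have lin: "linear h" unfolding h_def by (intro linear_compose_sub linear_turn) (simp add: linear_id[unfolded id_def])
  have "inj h"
    unfolding linear_injective_0[OF lin] using turn_fixpoint[OF t] by (auto simp: h_def)
  then have "surj h" using lin linear_injective_imp_surjective by blast
  then obtain q where q: "h q = h p - v" by (metis surjD)
  have rot: "rotation_about q t x = rotation_about p t x - v" for x
    using q by (simp add: rotation_about_eq h_def)
  then have "rotation_about q t ` S = (\<lambda>y. y - v) ` rotation_about p t ` S" by (simp add: image_image)
  then have inv: "rotation_about q t ` S = S" by (simp add: trans image_image)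
  have closed: "closed S" using S(1) by (rule compact_imp_closed)
  define x where "x = closest_point S q"
  have x: "x \<in> S" "\<forall>z\<in>S. dist q x \<le> dist q z"
    using closest_point_exists[OF closed S(3)] by (auto simp: x_def)
  have "rotation_about q t q = q" by (simp add: rotation_about_eq)
  then have "dist q (rotation_about q t x) = dist q x" using dist_rotation_about[of q t q x] by simp
  moreover have "rotation_about q t x \<in> S" using inv x(1) by blast
  ultimately have "rotation_about q t x = x"
    using any_closest_point_unique[OF S(2) closed _ x(1), of "rotation_about q t x" q] x(2) by simp
  then have "turn t (x - q) = x - q"
    by (simp add: rotation_about_eq linear_diff[OF linear_turn] algebra_simps)
  then have "q = x" using turn_fixpoint[OF t] by fastforce
  then show ?thesis using that x(1) inv by blast
qed

section \<open>Symmetry of Cheeger sets\<close>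

theorem corollary3p2:
  fixes k :: nat and \<Omega> C :: "(real^2) set"
  assumes "k \<ge> 2"
    and "rotationally_symmetric k \<Omega>"
    and "is_closed_cheeger_set \<Omega> C"
  shows "rotationally_symmetric k C"
proof -
  define t where "t = 2 * pi / real k"
  obtain p where \<Omega>: "compact \<Omega>" "convex \<Omega>" and p: "rotation_about p t ` \<Omega> = \<Omega>"
    using assms(2) by (auto simp: rotationally_symmetric_def planar_convex_body_def t_def)
  have C: "closed C" "convex C" "C \<subseteq> \<Omega>" "area C > 0" and opt: "perimeter C / area C = cheeger_constant \<Omega>"
    using assms(3) by (auto simp: is_closed_cheeger_set_def is_cheeger_set_def)
  have C_compact: "compact C" using C(1,3) \<Omega>(1) by (meson compact_imp_bounded bounded_subset compact_eq_bounded_closed)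
  have C_int: "interior C \<noteq> {}"
    using C(2,4) negligible_convex_interior[of C] by (auto simp: area_def negligible_iff_null_sets)
  have body: "planar_convex_body C" using C_compact C(2) C_int by (simp add: planar_convex_body_def)
  define L where "L = rotation_about p t ` C"
  have L: "compact L" "convex L" "interior L \<noteq> {}" "L \<subseteq> \<Omega>"
  proof -
    have eq: "L = (+) (p - turn t p) ` turn t ` C" by (simp add: L_def rotation_about_image)
    have "compact (turn t ` C)"
      using C_compact linear_turn by (intro compact_continuous_image linear_continuous_on) (simp_all add: linear_linear)
    then show "compact L" unfolding eq by (rule compact_translation)
    show "convex L" unfolding eq by (intro convex_translation convex_linear_image linear_turn C)
    show "interior L \<noteq> {}"
      unfolding eq using C_int by (simp add: interior_translation interior_injective_linear_image[OF linear_turn inj_turn])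
    show "L \<subseteq> \<Omega>" unfolding L_def using C(3) p by blast
  qed
  define M where "M = midpoints C L"
  have M: "compact M" "convex M" "interior M \<noteq> {}" "M \<subseteq> \<Omega>"
  proof -
    show "compact M" unfolding M_def by (rule compact_midpoints[OF C_compact L(1)])
    show "convex M" unfolding M_def by (rule convex_midpoints[OF C(2) L(2)])
    have "L \<noteq> {}" using L(3) by auto
    then show "interior M \<noteq> {}" unfolding M_def by (rule interior_midpoints[OF C_int])
    show "M \<subseteq> \<Omega>" unfolding M_def by (rule midpoints_subset_convex[OF \<Omega>(2) C(3) L(4)])
  qed
  have area_eq: "area S = ennreal (measure lebesgue S)" "0 < measure lebesgue S"
    if "compact S" "convex S" "interior S \<noteq> {}" for S :: "(real^2) set"
  proof -
    have lm: "S \<in> lmeasurable" using that(1) by (rule lmeasurable_compact)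
    then show "area S = ennreal (measure lebesgue S)" by (simp add: area_def emeasure_eq_measure2)
    have "\<not> negligible S" using that negligible_convex_interior by blast
    then show "0 < measure lebesgue S"
      using lm by (metis negligible_iff_measure zero_less_measure_iff measure_nonneg less_eq_real_def)
  qed
  obtain h where h: "0 < h" "perimeter C = ennreal h"
    using perimeter_pos[OF C_compact C(2) C_int] perimeter_finite[OF C_compact C(2) C_int]
    by (metis ennreal_0 less_top_ennreal order_less_le)
  \<comment> \<open>Perimeter is at most averaged, so optimality of \<open>C\<close> turns into an upper bound for the area of \<open>M\<close>.\<close>
  have "2 * perimeter M \<le> perimeter C + perimeter L"
    unfolding M_def by (rule perimeter_midpoints[OF C_compact C(2) C_int L(1-3)])
  also have "\<dots> \<le> perimeter C + perimeter C"
    unfolding L_def by (intro add_left_mono perimeter_rotation_about_le)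
  also have "\<dots> = 2 * ennreal h" by (simp add: h mult_2)
  finally have PM: "perimeter M \<le> ennreal h" by (simp add: ennreal_mult_le_mult_iff)
  have "measure lebesgue M \<le> measure lebesgue C"
  proof -
    have "cheeger_constant \<Omega> \<le> perimeter M / area M"
      unfolding cheeger_constant_def
      using M area_eq[OF M(1-3)] lmeasurable_compact[OF M(1)] by (intro INF_lower) auto
    also have "\<dots> \<le> ennreal h / area M" using PM by (rule divide_right_mono_ennreal)
    finally have "ennreal h / area C \<le> ennreal h / area M" using opt h by simp
    then have "h / measure lebesgue C \<le> h / measure lebesgue M"
      using h area_eq[OF M(1-3)] area_eq[OF C_compact C(2) C_int] by (simp add: divide_ennreal)
    then show ?thesis
      using h(1) area_eq(2)[OF M(1-3)] area_eq(2)[OF C_compact C(2) C_int] by (simp add: field_simps)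
  qed
  moreover have "measure lebesgue C = measure lebesgue L"
    unfolding L_def using lmeasurable_compact[OF C_compact] by (simp add: measure_rotation_about)
  ultimately obtain v where "L = (+) v ` C"
    using brunn_minkowski_equality[OF C_compact C(2) C_int L(1-3)] unfolding M_def by blast
  moreover have "cos t \<noteq> 1"
  proof -
    have "0 < t" "t \<le> pi" using assms(1) by (auto simp: t_def field_simps)
    then show ?thesis using cos_monotone_0_pi[of 0 t] by simp
  qed
  moreover have "C \<noteq> {}" using C_int by auto
  ultimately obtain q where "q \<in> C" "rotation_about q t ` C = C"
    using rotation_about_translated_center[OF C_compact C(2)] unfolding L_def by blast
  then show ?thesis using body by (auto simp: rotationally_symmetric_def t_def)
qed

end
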